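(* Let $n\ge1$. There exists a constant $c_n>0$ depending only on $n$ such that for every weight $w\in A_\infty$ on $\mathbb{R}^n$, $\log w\in\operatorname{BMO}$ and $$\|\log w\|_{\operatorname{BMO}}\le c_n\,\log\big(2[w]_{A_\infty}'\big)\,\big([w]_{A_\infty}-1\big).$$
   Context: Cubes $Q\subset\mathbb{R}^n$ have sides parallel to the coordinate axes. A weight is a locally integrable function $w$ on $\mathbb{R}^n$ with $0<w(x)<\infty$ for a.e. $x$; $w(Q)=\int_Q w\,dx$. For $1<p<\infty$, $w\in A_p$ means $[w]_{A_p}:=\sup_Q\left(\frac1{|Q|}\int_Q w\right)\left(\frac1{|Q|}\int_Q w^{1-p'}\right)^{p-1}<\infty$, $p'=p/(p-1)$; $w\in A_1$ means $\sup_Q\left(\frac1{|Q|}\int_Q w\right)\operatorname{ess\,sup}_Q (w^{-1})<\infty$. $A_\infty:=\bigcup_{p\ge1}A_p$; equivalently $w\in A_\infty$ iff either (hence both) of the following constants is finite: the Fujii--Wilson constant $[w]_{A_\infty}:=\sup_Q\frac1{w(Q)}\int_Q M(w\chi_Q)\,dx$, where $Mf(x)=\sup_{Q\ni x}\frac1{|Q|}\int_Q|f|$, and the Hruščev constant $[w]'_{A_\infty}:=\sup_Q\left(\frac1{|Q|}\int_Q w\right)\exp\left(\frac1{|Q|}\int_Q\log w^{-1}\right)$. The seminorm is $\|f\|_{\operatorname{BMO}}:=\sup_Q\frac1{|Q|}\int_Q|f-f_Q|\,dx$ with $f_Q=\frac1{|Q|}\int_Q f\,dx$; $f\in\operatorname{BMO}$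 means $f\in L^1_{\rm loc}(\mathbb{R}^n)$ and $\|f\|_{\operatorname{BMO}}<\infty$. *)

theory Defs
  imports "HOL-Analysis.Analysis" "HOL-Probability.Essential_Supremum"
begin

definition cubes :: "(real^'n) set set" where
  "cubes = {cbox a (\<chi> i. a $ i + l) | a l. l > 0}"

definition locally_integrable :: "(real^'n \<Rightarrow> real) \<Rightarrow> bool" where
  "locally_integrable f \<longleftrightarrow> (\<forall>K. compact K \<longrightarrow> set_integrable lebesgue K f)"

text \<open>Only meaningful for \<open>f\<close> integrable over \<open>Q\<close>; uses below are guarded accordingly.\<close>

definition avg :: "(real^'n) set \<Rightarrow> (real^'n \<Rightarrow> real) \<Rightarrow> real" where
  "avg Q f = (LINT x:Q|lebesgue. f x) / measure lebesgue Q"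

text \<open>
  Weights are real-valued, so they are finite by typing. They may take arbitrary values on a null
  set, where \<open>ln\<close>, \<open>inverse\<close> and \<open>powr\<close> need not have their usual meaning; every notion below
  is insensitive to null sets.
\<close>

definition weight :: "(real^'n \<Rightarrow> real) \<Rightarrow> bool" where
  "weight w \<longleftrightarrow> locally_integrable w \<and> (AE x in lebesgue. 0 < w x)"

text \<open>
  All constants take values in \<open>[0, \<infinity>]\<close>. If \<open>w powr (1 - p')\<close> is not integrable over \<open>Q\<close>,
  its integral is \<open>\<infinity>\<close>, and so is the product, since the average of a weight is positive.
\<close>

definition Ap_const :: "real \<Rightarrow> (real^'n \<Rightarrow> real) \<Rightarrow> ennreal" where
  "Ap_const p w = (let p' = p / (p - 1) in
     SUP Q\<in>cubes.
       if set_integrable lebesgue Q (\<lambda>x. w x powr (1 - p'))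
       then ennreal (avg Q w * avg Q (\<lambda>x. w x powr (1 - p')) powr (p - 1))
       else \<infinity>)"

definition A1_const :: "(real^'n \<Rightarrow> real) \<Rightarrow> ennreal" where
  "A1_const w =
     (SUP Q\<in>cubes. ennreal (avg Q w) * esssup (lebesgue_on Q) (\<lambda>x. ennreal (inverse (w x))))"

definition Ap :: "real \<Rightarrow> (real^'n \<Rightarrow> real) set" where
  "Ap p = {w. weight w \<and> (if p = 1 then A1_const w else Ap_const p w) < \<infinity>}"

definition A_inf :: "(real^'n \<Rightarrow> real) set" where
  "A_inf = (\<Union>p\<in>{1..}. Ap p)"

definition maximal :: "(real^'n \<Rightarrow> real) \<Rightarrow> real^'n \<Rightarrow> ennreal" where
  "maximal f x =
     (SUP Q\<in>{Q\<in>cubes. x \<in> Q}.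
       (\<integral>\<^sup>+y\<in>Q. ennreal \<bar>f y\<bar> \<partial>lebesgue) / ennreal (measure lebesgue Q))"

definition fujii_wilson :: "(real^'n \<Rightarrow> real) \<Rightarrow> ennreal" where
  "fujii_wilson w =
     (SUP Q\<in>cubes.
       (\<integral>\<^sup>+x\<in>Q. maximal (\<lambda>y. w y * indicator Q y) x \<partial>lebesgue)
         / ennreal (LINT x:Q|lebesgue. w x))"

text \<open>
  For a weight, the negative part of \<open>ln (inverse w)\<close> is bounded by \<open>w\<close>, hence integrable over
  \<open>Q\<close>. So the integral of \<open>ln (inverse w)\<close> always exists in \<open>(-\<infinity>, \<infinity>]\<close>, with value \<open>\<infinity>\<close>
  precisely when this function is not integrable.
\<close>

definition hruscev :: "(real^'n \<Rightarrow> real) \<Rightarrow> ennreal" where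
  "hruscev w =
     (SUP Q\<in>cubes.
       if set_integrable lebesgue Q (\<lambda>x. ln (inverse (w x)))
       then ennreal (avg Q w * exp (avg Q (\<lambda>x. ln (inverse (w x)))))
       else \<infinity>)"

text \<open>The seminorm is only meaningful for locally integrable \<open>f\<close>.\<close>

definition BMO_seminorm :: "(real^'n \<Rightarrow> real) \<Rightarrow> ennreal" where
  "BMO_seminorm f = (SUP Q\<in>cubes. ennreal (avg Q (\<lambda>x. \<bar>f x - avg Q f\<bar>)))"

definition BMO :: "(real^'n \<Rightarrow> real) set" where
  "BMO = {f. locally_integrable f \<and> BMO_seminorm f < \<infinity>}"

text \<open>Natural logarithm on \<open>[0, \<infinity>]\<close>.\<close>

definition eln :: "ennreal \<Rightarrow> ereal" where
  "eln t = (if t = \<infinity> then \<infinity> else if t = 0 then -\<infinity> else ereal (ln (enn2real t)))"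

end

(* Every average of w is dominated by the maximal function, so the Fujii-Wilson constant F forces
   the mean of |w - w_Q| over a cube Q to be at most 2 (F - 1) w_Q. Hence ln w is within O(F - 1)
   of ln w_Q in mean, except on the set E of points of Q where w < w_Q / 2, and |E| <= 2 (F - 1) |Q|.
   If F - 1 is small, a dyadic stopping time covers E by cubes of total measure O(|E|) on which
   the average of w is still comparable to w_Q; on each of them the Hruscev constant H bounds the
   mean of ln (w_Q / w) by ln H + O(1). If F - 1 is not small, the bound 2 (ln H + 2) for the mean
   oscillation of ln w, which follows directly from the definition of H, suffices.

   To avoid Lebesgue's differentiation theorem, exceptional sets are enclosed between a compact
   set K and an open set U: every sufficiently small cube is contained in U or misses K, so that
   finitely many dyadic subdivisions suffice. *)
theory Submission
  imports Defs
begin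

text \<open>Almost everywhere on Q the maximal function of w cut off to Q is at least max(w, w_Q),
  the sum of w_Q and the excess of w over w_Q. Integrated over Q, the term w_Q uses up the 1 in F
  and leaves F - 1 for the excess. The deficit has the same integral, since w - w_Q has mean zero.

  That maximal function is a supremum over uncountably many cubes and is not known here to be
  measurable, so its integral cannot be split over subcubes. Splitting is done instead for a
  measurable function below it, assembled cube by cube.

  With n the dimension and N = 2^(n+1), the regime of small F - 1 is 4 N (F - 1) <= 1. Then |E| is
  at most |Q| / (2 N), and another |Q| / (2 N) is left for the open set enclosing E, so that Q
  itself passes the test of the stopping time, which is a filling of at most 1 / N.

  In both regimes ln H appears together with additive constants. Since ln 2 >= 1 / 2, the factor 2
  inside the logarithm absorbs them, even when H = 1.\<close>

section \<open>Half-open cubes and dyadic subdivision\<close>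

definition hcube :: "real^'n \<Rightarrow> real \<Rightarrow> (real^'n) set" where
  "hcube a l = {x. \<forall>i. a $ i \<le> x $ i \<and> x $ i < a $ i + l}"

text \<open>The set \<open>\<sigma>\<close> collects the coordinates in which the upper half of the
  side is taken, so the 2^n dyadic children of a cube are indexed by all subsets of the index
  type.\<close>

definition corner :: "real^'n \<Rightarrow> real \<Rightarrow> 'n set \<Rightarrow> real^'n" where
  "corner a l \<sigma> = (\<chi> i. a $ i + (if i \<in> \<sigma> then l / 2 else 0))"

text \<open>A point of the cube determines the one child containing it. Half-open sides make the
  children an exact partition, with no shared faces to discard.\<close>

lemma mem_hcube_corner:
  assumes "0 < l"
  shows "x \<in> hcube (corner a l \<sigma>) (l / 2) \<longleftrightarrow>
           x \<in> hcube a l \<and> \<sigma> = {i. a $ i + l / 2 \<le> x $ i}"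
proof -
  have "(\<forall>i. a $ i + (if i \<in> \<sigma> then l / 2 else 0) \<le> x $ i \<and>
             x $ i < a $ i + (if i \<in> \<sigma> then l / 2 else 0) + l / 2) \<longleftrightarrow>
        (\<forall>i. (a $ i \<le> x $ i \<and> x $ i < a $ i + l) \<and> (i \<in> \<sigma> \<longleftrightarrow> a $ i + l / 2 \<le> x $ i))"
    by (rule all_cong1) (use assms in auto)
  then show ?thesis
    by (auto simp: hcube_def corner_def)
qed

lemma hcube_corner_subset: "0 < l \<Longrightarrow> hcube (corner a l \<sigma>) (l / 2) \<subseteq> hcube a l"
  using mem_hcube_corner by blast

lemma sum_indicator_corners:
  fixes x :: "real^'n"
  assumes "0 < l"
  shows "(\<Sum>\<sigma>\<in>UNIV. indicator (hcube (corner a l \<sigma>) (l / 2)) x) = (indicator (hcube a l) x :: ennreal)"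
proof -
  have "(\<Sum>\<sigma>\<in>UNIV. indicator (hcube (corner a l \<sigma>) (l / 2)) x :: ennreal)
      = (\<Sum>\<sigma>\<in>UNIV. if \<sigma> = {i. a $ i + l / 2 \<le> x $ i} then indicator (hcube a l) x else 0)"
    by (intro sum.cong) (auto simp: indicator_def mem_hcube_corner[OF assms])
  then show ?thesis
    by simp
qed

lemma hcube_subset_cbox: "hcube a l \<subseteq> cbox a (\<chi> i. a $ i + l)"
  by (auto simp: hcube_def mem_box_cart less_imp_le)

lemma box_subset_hcube: "box a (\<chi> i. a $ i + l) \<subseteq> hcube a l"
  by (auto simp: hcube_def mem_box_cart less_imp_le)

lemma sets_hcube [measurable]: "hcube a l \<in> sets lebesgue"
proof -
  have "hcube a l \<in> sets borel"
    unfolding hcube_def by measurable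
  then show ?thesis
    by simp
qed

lemma AE_hcube_iff_cbox:
  fixes a :: "real^'n"
  shows "AE x in lebesgue. x \<in> hcube a l \<longleftrightarrow> x \<in> cbox a (\<chi> i. a $ i + l)"
proof -
  let ?b = "\<chi> i. a $ i + l"
  have "negligible (cbox a ?b - box a ?b)"
    by (rule negligible_frontier_interval)
  then have "AE x in lebesgue. x \<notin> cbox a ?b - box a ?b"
    by (metis AE_not_in negligible_iff_null_sets)
  then show ?thesis
    by eventually_elim (use hcube_subset_cbox box_subset_hcube in blast)
qed

lemma measure_cbox_cube:
  fixes a :: "real^'n"
  assumes "0 \<le> l"
  shows "measure lebesgue (cbox a (\<chi> i. a $ i + l)) = l ^ CARD('n)"
proof -
  have "cbox a (\<chi> i. a $ i + l) \<noteq> {}"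
    using assms by (auto simp: interval_ne_empty_cart)
  then show ?thesis
    by (simp add: content_cbox_cart)
qed

lemma emeasure_cbox_cube:
  fixes a :: "real^'n"
  assumes "0 \<le> l"
  shows "emeasure lebesgue (cbox a (\<chi> i. a $ i + l)) = ennreal (l ^ CARD('n))"
  using measure_cbox_cube[OF assms, of a] emeasure_eq_ennreal_measure[of lebesgue "cbox a (\<chi> i. a $ i + l)"]
  by (simp add: emeasure_lborel_cbox_eq)

lemma emeasure_hcube:
  fixes a :: "real^'n"
  assumes "0 \<le> l"
  shows "emeasure lebesgue (hcube a l) = ennreal (l ^ CARD('n))"
proof -
  have "emeasure lebesgue (hcube a l) = emeasure lebesgue (cbox a (\<chi> i. a $ i + l))"
    by (rule emeasure_eq_AE[OF AE_hcube_iff_cbox]) auto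
  then show ?thesis
    using emeasure_cbox_cube[OF assms, of a] by (simp del: emeasure_completion)
qed

text \<open>Bridge between the closed cubes of the definitions and the half-open cubes of the
  subdivision, which differ by a null set. Being valid for arbitrary \<open>f\<close>, it also
  covers the maximal function.\<close>

lemma nn_integral_hcube_eq_cbox:
  "(\<integral>\<^sup>+x\<in>hcube a l. f x \<partial>lebesgue) = (\<integral>\<^sup>+x\<in>cbox a (\<chi> i. a $ i + l). f x \<partial>lebesgue)"
  by (rule nn_integral_cong_AE, rule eventually_mono[OF AE_hcube_iff_cbox]) (auto simp: indicator_def)

lemma nn_integral_hcube_corners:
  fixes a :: "real^'n"
  assumes "0 < l" and [measurable]: "f \<in> borel_measurable lebesgue"
  shows "(\<integral>\<^sup>+x\<in>hcube a l. f x \<partial>lebesgue)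
       = (\<Sum>\<sigma>\<in>UNIV. \<integral>\<^sup>+x\<in>hcube (corner a l \<sigma>) (l / 2). f x \<partial>lebesgue)"
proof -
  have "(\<integral>\<^sup>+x\<in>hcube a l. f x \<partial>lebesgue)
      = (\<integral>\<^sup>+x. (\<Sum>\<sigma>\<in>UNIV. f x * indicator (hcube (corner a l \<sigma>) (l / 2)) x) \<partial>lebesgue)"
    by (simp add: sum_indicator_corners[OF assms(1), symmetric] sum_distrib_left)
  also have "\<dots> = (\<Sum>\<sigma>\<in>UNIV. \<integral>\<^sup>+x\<in>hcube (corner a l \<sigma>) (l / 2). f x \<partial>lebesgue)"
    by (rule nn_integral_sum) simp
  finally show ?thesis .
qed

text \<open>Induction from small scales to large ones: finitely many halvings bring any side below
  \<open>\<epsilon>\<close>, so a property of all small cubes that passes from the children to the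
  parent holds for every cube.\<close>

lemma hcube_induct [consumes 2, case_names small corners]:
  assumes "0 < l" and "0 < \<epsilon>"
    and small: "\<And>a l. 0 < l \<Longrightarrow> l < \<epsilon> \<Longrightarrow> P a l"
    and corners: "\<And>a l. 0 < l \<Longrightarrow> (\<And>\<sigma>. P (corner a l \<sigma>) (l / 2)) \<Longrightarrow> P a l"
  shows "P a l"
proof -
  have "P a l" if "0 < l" "l < \<epsilon> * 2 ^ N" for N :: nat and a l
    using that
  proof (induction N arbitrary: a l)
    case 0
    then show ?case
      using small by simp
  next
    case (Suc N)
    show ?case
      by (rule corners) (use Suc in auto)
  qed
  moreover obtain N :: nat where "l / \<epsilon> < 2 ^ N"
    using real_arch_pow[of 2 "l / \<epsilon>"] by auto
  ultimately show ?thesis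
    using assms by (auto simp: field_simps)
qed

lemma dist_hcube_le:
  fixes x y :: "real^'n"
  assumes "x \<in> hcube a l" "y \<in> hcube a l"
  shows "dist x y \<le> real CARD('n) * l"
proof -
  have "dist x y \<le> (\<Sum>i\<in>UNIV. \<bar>(x - y) $ i\<bar>)"
    unfolding dist_norm by (rule norm_le_l1_cart)
  also have "\<dots> \<le> (\<Sum>i\<in>(UNIV :: 'n set). l)"
  proof (rule sum_mono)
    fix i :: 'n
    have "a $ i \<le> x $ i \<and> x $ i < a $ i + l" "a $ i \<le> y $ i \<and> y $ i < a $ i + l"
      using assms by (auto simp: hcube_def)
    then show "\<bar>(x - y) $ i\<bar> \<le> l"
      by (auto simp: abs_le_iff)
  qed
  finally show ?thesis
    by simp
qed

text \<open>The compact set \<open>K\<close> has positive distance \<open>d\<close> from the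
  complement of \<open>U\<close>, while a cube of side \<open>l\<close> has diameter at most
  \<open>CARD('n) * l\<close>.\<close>

lemma small_hcube_dichotomy:
  fixes K U :: "(real^'n) set"
  assumes "compact K" "open U" "K \<subseteq> U"
  obtains \<epsilon> where "0 < \<epsilon>" "\<And>a l. l < \<epsilon> \<Longrightarrow> hcube a l \<subseteq> U \<or> hcube a l \<inter> K = {}"
proof -
  obtain d where d: "0 < d" "\<And>x y. x \<in> K \<Longrightarrow> y \<in> - U \<Longrightarrow> d \<le> dist x y"
    using separate_compact_closed[of K "- U"] assms
    by (metis ComplD closed_Compl disjoint_eq_subset_Compl double_complement)
  show ?thesis
  proof
    show "0 < d / real CARD('n)"
      using d by simp
    fix a :: "real^'n" and l
    assume "l < d / real CARD('n)"
    then have *: "real CARD('n) * l < d"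
      by (simp add: field_simps)
    show "hcube a l \<subseteq> U \<or> hcube a l \<inter> K = {}"
    proof (rule ccontr)
      assume "\<not> ?thesis"
      then obtain x y where "x \<in> hcube a l" "x \<in> K" "y \<in> hcube a l" "y \<notin> U"
        by blast
      then show False
        using d(2)[of x y] dist_hcube_le[of x a l y] * by auto
    qed
  qed
qed

text \<open>Up to a null set, \<open>G\<close> is an F-sigma set, hence an increasing union of
  compact sets, and monotone convergence carries the bound over.\<close>

lemma nn_integral_le_of_compact_subsets:
  fixes G :: "(real^'n) set"
  assumes [measurable]: "f \<in> borel_measurable lebesgue" "G \<in> sets lebesgue"
    and bound: "\<And>K. compact K \<Longrightarrow> K \<subseteq> G \<Longrightarrow> (\<integral>\<^sup>+x\<in>K. f x \<partial>lebesgue) \<le> B"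
  shows "(\<integral>\<^sup>+x\<in>G. f x \<partial>lebesgue) \<le> B"
proof -
  obtain C T where CT: "fsigma C" "negligible T" "C \<union> T = G"
    using lebesgue_set_almost_fsigma[OF assms(2)] negligible_iff_null_sets by metis
  obtain F :: "nat \<Rightarrow> (real^'n) set" where F: "range F \<subseteq> Collect compact" "C = \<Union>(range F)"
    using CT(1) fsigma_Union_compact by metis
  define K where "K n = (\<Union>i\<le>n. F i)" for n
  have K: "compact (K n)" "K n \<subseteq> G" for n
    using F CT(3) by (auto simp: K_def)
  have [measurable]: "K n \<in> sets lebesgue" for n
    using K(1) by (simp add: borel_compact)
  have "(\<integral>\<^sup>+x\<in>G. f x \<partial>lebesgue) = (\<integral>\<^sup>+x. (SUP n. f x * indicator (K n) x) \<partial>lebesgue)"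
  proof (rule nn_integral_cong_AE)
    have "AE x in lebesgue. x \<notin> T"
      using CT(2) by (metis AE_not_in negligible_iff_null_sets)
    then show "AE x in lebesgue. f x * indicator G x = (SUP n. f x * indicator (K n) x)"
    proof eventually_elim
      case (elim x)
      show ?case
      proof (cases "x \<in> C")
        case True
        then obtain n where n: "x \<in> K n"
          using F(2) by (auto simp: K_def)
        have "(SUP n. f x * indicator (K n) x) = f x"
        proof (rule antisym)
          show "(SUP n. f x * indicator (K n) x) \<le> f x"
            by (auto intro!: SUP_least simp: indicator_def)
          show "f x \<le> (SUP n. f x * indicator (K n) x)"
            by (rule SUP_upper2[of n]) (use n in auto)
        qed
        then show ?thesis
          using True CT(3) by auto
      next
        case False
        then have "x \<notin> K n" for n
          using F(2) by (auto simp: K_def)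
        then show ?thesis
          using False elim CT(3) by auto
      qed
    qed
  qed
  also have "\<dots> = (SUP n. \<integral>\<^sup>+x\<in>K n. f x \<partial>lebesgue)"
  proof (rule nn_integral_monotone_convergence_SUP)
    show "incseq (\<lambda>n x. f x * indicator (K n) x)"
    proof (intro incseq_SucI le_funI mult_left_mono)
      fix n x
      have "K n \<subseteq> K (Suc n)"
        unfolding K_def by (rule UN_mono) auto
      then show "indicator (K n) x \<le> (indicator (K (Suc n)) x :: ennreal)"
        by (auto simp: indicator_def)
    qed auto
  qed simp
  also have "\<dots> \<le> B"
    by (rule SUP_least) (rule bound[OF K])
  finally show ?thesis .
qed

section \<open>Averages over cubes\<close>

lemma cubesE:
  assumes "Q \<in> cubes"
  obtains a l where "0 < l" "Q = cbox a (\<chi> i. a $ i + l)"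
  using assms by (auto simp: cubes_def)

lemma cube_lmeasurable: "Q \<in> cubes \<Longrightarrow> Q \<in> lmeasurable"
  by (auto elim: cubesE)

lemma cube_sets [measurable_dest]: "Q \<in> cubes \<Longrightarrow> Q \<in> sets lebesgue"
  by (auto elim: cubesE)

lemma cube_compact: "Q \<in> cubes \<Longrightarrow> compact Q"
  by (auto elim: cubesE)

lemma cube_measure_pos: "Q \<in> cubes \<Longrightarrow> 0 < measure lebesgue Q"
  by (metis cubesE measure_cbox_cube less_imp_le zero_less_power)

lemma emeasure_cube: "Q \<in> cubes \<Longrightarrow> emeasure lebesgue Q = ennreal (measure lebesgue Q)"
  by (rule emeasure_eq_measure2) (simp add: cube_lmeasurable)

lemma set_integrable_const_cube [simp]: "Q \<in> cubes \<Longrightarrow> set_integrable lebesgue Q (\<lambda>x. c :: real)"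
  using cube_lmeasurable[of Q] by (simp add: set_integrable_def fmeasurable_def)

lemma set_integrable_max_0:
  fixes f :: "'a \<Rightarrow> real"
  assumes "set_integrable M A f"
  shows "set_integrable M A (\<lambda>x. max 0 (f x))"
proof -
  have "set_integrable M A (\<lambda>x. (f x + \<bar>f x\<bar>) / 2)"
    using assms by (intro set_integrable_divide set_integral_add set_integrable_abs) auto
  moreover have "(\<lambda>x. (f x + \<bar>f x\<bar>) / 2) = (\<lambda>x. max 0 (f x))"
    by (auto simp: max_def)
  ultimately show ?thesis
    by simp
qed

lemma avg_const [simp]: "Q \<in> cubes \<Longrightarrow> avg Q (\<lambda>x. c) = c"
  using cube_measure_pos[of Q] cube_lmeasurable[of Q]
  by (simp add: avg_def set_lebesgue_integral_def fmeasurable_def)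

lemma avg_add:
  "set_integrable lebesgue Q f \<Longrightarrow> set_integrable lebesgue Q g \<Longrightarrow>
    avg Q (\<lambda>x. f x + g x) = avg Q f + avg Q g"
  by (simp add: avg_def add_divide_distrib set_integral_add)

lemma avg_diff:
  "set_integrable lebesgue Q f \<Longrightarrow> set_integrable lebesgue Q g \<Longrightarrow>
    avg Q (\<lambda>x. f x - g x) = avg Q f - avg Q g"
  by (simp add: avg_def diff_divide_distrib set_integral_diff)

lemma avg_cmult: "avg Q (\<lambda>x. c * f x) = c * avg Q f"
  by (simp add: avg_def)

lemma avg_cong_AE:
  assumes "AE x in lebesgue. f x = g x"
    and "f \<in> borel_measurable lebesgue" "g \<in> borel_measurable lebesgue" "Q \<in> sets lebesgue"
  shows "avg Q f = avg Q g"
  unfolding avg_def using assms by (subst set_lebesgue_integral_cong_AE[where g = g]) auto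

lemma avg_mono:
  assumes "set_integrable lebesgue Q f" "set_integrable lebesgue Q g" "AE x in lebesgue. x \<in> Q \<longrightarrow> f x \<le> g x"
  shows "avg Q f \<le> avg Q g"
  unfolding avg_def
  by (intro divide_right_mono set_integral_mono_AE assms measure_nonneg)

lemma nn_integral_eq_avg:
  assumes "Q \<in> cubes" "set_integrable lebesgue Q f" "AE x in lebesgue. 0 \<le> f x"
  shows "(\<integral>\<^sup>+x\<in>Q. ennreal (f x) \<partial>lebesgue) = ennreal (measure lebesgue Q * avg Q f)"
proof -
  have "(\<integral>\<^sup>+x\<in>Q. ennreal (f x) \<partial>lebesgue) = (\<integral>\<^sup>+x. ennreal (indicator Q x *\<^sub>R f x) \<partial>lebesgue)"
    by (intro nn_integral_cong) (auto simp: indicator_def)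
  also have "\<dots> = ennreal (LINT x:Q|lebesgue. f x)"
    unfolding set_lebesgue_integral_def using assms(2,3)
    by (intro nn_integral_eq_integral) (auto simp: set_integrable_def indicator_def)
  finally show ?thesis
    using cube_measure_pos[OF assms(1)] by (simp add: avg_def)
qed

lemma avg_pos:
  assumes "Q \<in> cubes" "set_integrable lebesgue Q f" "AE x in lebesgue. 0 < f x"
  shows "0 < avg Q f"
proof (rule ccontr)
  assume neg: "\<not> 0 < avg Q f"
  have int: "integrable lebesgue (\<lambda>x. indicator Q x *\<^sub>R f x)"
    using assms(2) by (simp add: set_integrable_def)
  have nonneg: "AE x in lebesgue. 0 \<le> indicator Q x *\<^sub>R f x"
    using assms(3) by eventually_elim (auto simp: indicator_def)
  have "(LINT x|lebesgue. indicator Q x *\<^sub>R f x) = 0"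
    using neg integral_nonneg_AE[OF nonneg] cube_measure_pos[OF assms(1)]
    by (simp add: avg_def set_lebesgue_integral_def zero_less_divide_iff)
  then have "AE x in lebesgue. indicator Q x *\<^sub>R f x = 0"
    using integral_nonneg_eq_0_iff_AE[OF int nonneg] by simp
  then have "AE x in lebesgue. x \<notin> Q"
    using assms(3) by eventually_elim (auto simp: indicator_def)
  then have "emeasure lebesgue Q = 0"
    using AE_iff_measurable[OF cube_sets[OF assms(1)], of "\<lambda>x. x \<notin> Q"] by simp
  then show False
    using cube_measure_pos[OF assms(1)] by (simp add: measure_def)
qed

text \<open>Jensen's inequality for the logarithm, obtained by averaging its tangent line at the
  mean \<open>c\<close>: ln t <= ln c - 1 + t / c.\<close>

lemma avg_ln_le:
  assumes Q: "Q \<in> cubes" and f: "set_integrable lebesgue Q f" "AE x in lebesgue. 0 < f x"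
    and ln: "set_integrable lebesgue Q (\<lambda>x. ln (f x))"
  shows "avg Q (\<lambda>x. ln (f x)) \<le> ln (avg Q f)"
proof -
  let ?c = "avg Q f"
  have c: "0 < ?c"
    by (rule avg_pos[OF Q f])
  have "avg Q (\<lambda>x. ln (f x)) \<le> avg Q (\<lambda>x. (ln ?c - 1) + inverse ?c * f x)"
  proof (rule avg_mono[OF ln])
    show "set_integrable lebesgue Q (\<lambda>x. (ln ?c - 1) + inverse ?c * f x)"
      using Q f(1) by (intro set_integral_add set_integrable_mult_right) auto
    show "AE x in lebesgue. x \<in> Q \<longrightarrow> ln (f x) \<le> (ln ?c - 1) + inverse ?c * f x"
      using f(2)
    proof eventually_elim
      case (elim x)
      have "ln (f x / ?c) \<le> f x / ?c - 1"
        using elim c by (intro ln_le_minus_one) auto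
      moreover have "ln (f x / ?c) = ln (f x) - ln ?c"
        using elim c by (simp add: ln_div)
      ultimately show ?case
        by (simp add: field_simps)
    qed
  qed
  also have "\<dots> = (ln ?c - 1) + inverse ?c * ?c"
    using Q f(1) by (subst avg_add) (auto simp: avg_cmult)
  finally show ?thesis
    using c by simp
qed

text \<open>The mean of \<open>f\<close> differs from \<open>c\<close> by at most the mean of |f -
  c|. This allows the oscillation of \<open>ln w\<close> to be measured from
  \<open>ln (avg Q w)\<close> instead of from the mean of \<open>ln w\<close>, at the price of a
  factor 2.\<close>

lemma avg_abs_diff_avg_le:
  assumes Q: "Q \<in> cubes" and f: "set_integrable lebesgue Q f"
  shows "avg Q (\<lambda>x. \<bar>f x - avg Q f\<bar>) \<le> 2 * avg Q (\<lambda>x. \<bar>f x - c\<bar>)"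
proof -
  have int: "set_integrable lebesgue Q (\<lambda>x. f x - d)" for d
    using Q f by (intro set_integral_diff) auto
  have abs: "set_integrable lebesgue Q (\<lambda>x. \<bar>f x - d\<bar>)" for d
    by (rule set_integrable_abs[OF int])
  have "\<bar>avg Q f - c\<bar> = \<bar>avg Q (\<lambda>x. f x - c)\<bar>"
    using Q f by (simp add: avg_diff)
  also have "\<dots> \<le> avg Q (\<lambda>x. \<bar>f x - c\<bar>)"
  proof (rule abs_leI)
    show "avg Q (\<lambda>x. f x - c) \<le> avg Q (\<lambda>x. \<bar>f x - c\<bar>)"
      by (rule avg_mono[OF int abs]) auto
    have "- avg Q (\<lambda>x. f x - c) = avg Q (\<lambda>x. - 1 * (f x - c))"
      by (subst avg_cmult) simp
    also have "\<dots> \<le> avg Q (\<lambda>x. \<bar>f x - c\<bar>)"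
      by (rule avg_mono[OF set_integrable_mult_right[OF int] abs]) auto
    finally show "- avg Q (\<lambda>x. f x - c) \<le> avg Q (\<lambda>x. \<bar>f x - c\<bar>)" .
  qed
  finally have shift: "\<bar>avg Q f - c\<bar> \<le> avg Q (\<lambda>x. \<bar>f x - c\<bar>)" .
  have "avg Q (\<lambda>x. \<bar>f x - avg Q f\<bar>) \<le> avg Q (\<lambda>x. \<bar>f x - c\<bar> + \<bar>avg Q f - c\<bar>)"
    using Q by (intro avg_mono set_integral_add abs) auto
  also have "\<dots> = avg Q (\<lambda>x. \<bar>f x - c\<bar>) + \<bar>avg Q f - c\<bar>"
    using Q by (simp add: avg_add[OF abs])
  finally show ?thesis
    using shift by simp
qed

section \<open>Weights and the Hruscev constant\<close>

text \<open>A locally integrable function is the pointwise limit of its cut-offs to growing balls,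
  each of which is integrable.\<close>

lemma locally_integrable_imp_measurable:
  assumes "locally_integrable f"
  shows "f \<in> borel_measurable lebesgue"
proof (rule borel_measurable_LIMSEQ_real)
  fix k :: nat
  have "set_integrable lebesgue (cball 0 (real k)) f"
    using assms by (simp add: locally_integrable_def)
  then show "(\<lambda>x. indicator (cball 0 (real k)) x *\<^sub>R f x) \<in> borel_measurable lebesgue"
    by (auto simp: set_integrable_def dest: borel_measurable_integrable)
next
  fix x :: "real^'a"
  obtain N :: nat where "norm x \<le> real N"
    using real_arch_simple by blast
  then have "\<forall>\<^sub>F k in sequentially. indicator (cball 0 (real k)) x *\<^sub>R f x = f x"
    by (intro eventually_sequentiallyI[of N]) auto
  then show "(\<lambda>k. indicator (cball 0 (real k)) x *\<^sub>R f x) \<longlonglongrightarrow> f x"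
    by (rule tendsto_eventually)
qed

lemma locally_integrable_cubesI:
  fixes f :: "real^'n \<Rightarrow> real"
  assumes "\<And>Q. Q \<in> cubes \<Longrightarrow> set_integrable lebesgue Q f"
  shows "locally_integrable f"
  unfolding locally_integrable_def
proof (intro allI impI)
  fix K :: "(real^'n) set"
  assume K: "compact K"
  then obtain b where b: "0 < b" "\<And>x. x \<in> K \<Longrightarrow> norm x \<le> b"
    using compact_imp_bounded bounded_pos by metis
  let ?a = "(\<chi> i. - b) :: real^'n"
  let ?Q = "cbox ?a (\<chi> i. ?a $ i + 2 * b)"
  have "?Q \<in> cubes"
    using b(1) by (auto simp: cubes_def intro!: exI[of _ ?a] exI[of _ "2 * b"])
  moreover have "K \<subseteq> ?Q"
  proof
    fix x assume "x \<in> K"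
    then have "\<bar>x $ i\<bar> \<le> b" for i
      using b(2) component_le_norm_cart order_trans by blast
    then show "x \<in> ?Q"
      by (auto simp: mem_box_cart abs_le_iff minus_le_iff)
  qed
  ultimately show "set_integrable lebesgue K f"
    using K by (intro set_integrable_subset[OF assms]) (auto simp: borel_compact)
qed

lemma
  assumes "weight w"
  shows weight_measurable: "w \<in> borel_measurable lebesgue"
    and weight_pos: "AE x in lebesgue. 0 < w x"
    and weight_integrable: "Q \<in> cubes \<Longrightarrow> set_integrable lebesgue Q w"
    and weight_avg_pos: "Q \<in> cubes \<Longrightarrow> 0 < avg Q w"
proof -
  show "w \<in> borel_measurable lebesgue" and pos: "AE x in lebesgue. 0 < w x"
    using assms locally_integrable_imp_measurable by (auto simp: weight_def)
  show int: "set_integrable lebesgue Q w" if "Q \<in> cubes" for Q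
    using assms cube_compact[OF that] by (auto simp: weight_def locally_integrable_def)
  show "0 < avg Q w" if "Q \<in> cubes" for Q
    by (rule avg_pos[OF that int[OF that] pos])
qed

lemma set_integrable_ln_inverse_iff:
  assumes w: "weight w" and Q: "Q \<in> cubes"
  shows "set_integrable lebesgue Q (\<lambda>x. ln (inverse (w x))) \<longleftrightarrow> set_integrable lebesgue Q (\<lambda>x. ln (w x))"
    and "avg Q (\<lambda>x. ln (inverse (w x))) = - avg Q (\<lambda>x. ln (w x))"
proof -
  note [measurable] = weight_measurable[OF w] cube_sets[OF Q]
  have eq: "AE x in lebesgue. ln (inverse (w x)) = - 1 * ln (w x)"
    using weight_pos[OF w] by eventually_elim (simp add: ln_inverse)
  have "set_integrable lebesgue Q (\<lambda>x. ln (inverse (w x))) \<longleftrightarrow> set_integrable lebesgue Q (\<lambda>x. - 1 * ln (w x))"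
    using eq by (intro set_integrable_cong_AE) auto
  then show "set_integrable lebesgue Q (\<lambda>x. ln (inverse (w x))) \<longleftrightarrow> set_integrable lebesgue Q (\<lambda>x. ln (w x))"
    by (simp add: set_integrable_def)
  have "avg Q (\<lambda>x. ln (inverse (w x))) = avg Q (\<lambda>x. - 1 * ln (w x))"
    by (rule avg_cong_AE[OF eq]) auto
  then show "avg Q (\<lambda>x. ln (inverse (w x))) = - avg Q (\<lambda>x. ln (w x))"
    by (subst (asm) avg_cmult) simp
qed

text \<open>A finite bound excludes the branch \<open>\<infinity>\<close> in \<open>hruscev\<close>,
  hence the integrability. That \<open>H\<close> is at least 1 is Jensen's inequality:
  \<open>avg_ln_le\<close> makes the left side of the third claim non-negative.\<close>

lemma
  assumes w: "weight w" and H: "hruscev w \<le> ennreal H" and Q: "Q \<in> cubes"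
  shows hruscev_integrable: "set_integrable lebesgue Q (\<lambda>x. ln (w x))"
    and hruscev_ge_1: "1 \<le> H"
    and hruscev_avg_ln: "ln (avg Q w) - avg Q (\<lambda>x. ln (w x)) \<le> ln H"
proof -
  have "(if set_integrable lebesgue Q (\<lambda>x. ln (inverse (w x)))
         then ennreal (avg Q w * exp (avg Q (\<lambda>x. ln (inverse (w x)))))
         else \<infinity>) \<le> ennreal H"
    using H Q unfolding hruscev_def by (meson SUP_upper order_trans)
  then have int: "set_integrable lebesgue Q (\<lambda>x. ln (inverse (w x)))"
    and le: "ennreal (avg Q w * exp (avg Q (\<lambda>x. ln (inverse (w x))))) \<le> ennreal H"
    by (auto split: if_splits simp: top_unique)
  show ln: "set_integrable lebesgue Q (\<lambda>x. ln (w x))"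
    using int set_integrable_ln_inverse_iff[OF w Q] by simp
  have pos: "0 < avg Q w * exp (- avg Q (\<lambda>x. ln (w x)))"
    using weight_avg_pos[OF w Q] by simp
  moreover have *: "avg Q w * exp (- avg Q (\<lambda>x. ln (w x))) \<le> H"
    using le pos set_integrable_ln_inverse_iff[OF w Q]
    by (metis ennreal_le_iff2 linorder_not_less)
  ultimately have "ln (avg Q w * exp (- avg Q (\<lambda>x. ln (w x)))) \<le> ln H"
    by simp
  then show le_ln: "ln (avg Q w) - avg Q (\<lambda>x. ln (w x)) \<le> ln H"
    using weight_avg_pos[OF w Q] by (simp add: ln_mult)
  have "0 \<le> ln H"
    using le_ln avg_ln_le[OF Q weight_integrable[OF w Q] weight_pos[OF w] ln] by linarith
  then show "1 \<le> H"
    using pos * ln_ge_zero_iff[of H] by linarith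
qed

section \<open>Finiteness of the Hruscev constant on \<open>A_inf\<close>\<close>

text \<open>Treats all exponents at once: \<open>v\<close> is the dual weight, equal to
  \<open>w powr (1 - p')\<close> with \<open>t = p - 1\<close> for p > 1, and to
  \<open>inverse w\<close> with \<open>t = 1\<close> for p = 1. Integrability holds because ln w <=
  w and - ln w = t ln v <= t v; the estimate is Jensen's inequality for \<open>v\<close>.\<close>

lemma
  assumes w: "weight w" and Q: "Q \<in> cubes" and t: "0 < t"
    and v: "set_integrable lebesgue Q v" "v \<in> borel_measurable lebesgue"
    and vw: "AE x in lebesgue. 0 < v x \<and> t * ln (v x) = - ln (w x)"
  shows integrable_ln_of_dual: "set_integrable lebesgue Q (\<lambda>x. ln (inverse (w x)))"
    and exp_avg_ln_le_dual: "exp (avg Q (\<lambda>x. ln (inverse (w x)))) \<le> avg Q v powr t"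
proof -
  note [measurable] = weight_measurable[OF w] cube_sets[OF Q] v(2)
  have lnw: "set_integrable lebesgue Q (\<lambda>x. ln (w x))"
  proof (rule set_integrable_bound)
    show "set_integrable lebesgue Q (\<lambda>x. w x + t * v x)"
      using weight_integrable[OF w Q] v(1) by auto
    show "set_borel_measurable lebesgue Q (\<lambda>x. ln (w x))"
      unfolding set_borel_measurable_def by measurable
    have "AE x in lebesgue. norm (ln (w x)) \<le> norm (w x + t * v x)"
      using vw weight_pos[OF w]
    proof eventually_elim
      case (elim x)
      have "ln (w x) \<le> w x" "ln (v x) \<le> v x"
        using elim ln_le_minus_one[of "w x"] ln_le_minus_one[of "v x"] by auto
      moreover have "0 < t * v x"
        using elim t by simp
      moreover have "t * ln (v x) \<le> t * v x"
        using t by (intro mult_left_mono \<open>ln (v x) \<le> v x\<close>) simp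
      ultimately show ?case
        unfolding real_norm_def using elim by linarith
    qed
    then show "AE x\<in>Q in lebesgue. norm (ln (w x)) \<le> norm (w x + t * v x)"
      by auto
  qed
  then show "set_integrable lebesgue Q (\<lambda>x. ln (inverse (w x)))"
    using set_integrable_ln_inverse_iff[OF w Q] by simp
  have eq: "AE x in lebesgue. ln (v x) = (- 1 / t) * ln (w x)"
    using vw by eventually_elim (use t in \<open>auto simp: field_simps\<close>)
  have "set_integrable lebesgue Q (\<lambda>x. (- 1 / t) * ln (w x))"
    by (rule set_integrable_mult_right[OF lnw])
  then have lnv: "set_integrable lebesgue Q (\<lambda>x. ln (v x))"
    by (subst set_integrable_cong_AE[where g = "\<lambda>x. (- 1 / t) * ln (w x)"]) (use eq in auto)
  have pos: "AE x in lebesgue. 0 < v x"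
    using vw by eventually_elim simp
  have "avg Q (\<lambda>x. ln (v x)) = (- 1 / t) * avg Q (\<lambda>x. ln (w x))"
    by (subst avg_cong_AE[OF eq]) (simp_all only: avg_cmult, auto)
  moreover have "avg Q (\<lambda>x. ln (v x)) \<le> ln (avg Q v)"
    by (rule avg_ln_le[OF Q v(1) pos lnv])
  moreover have "t * avg Q (\<lambda>x. ln (v x)) \<le> t * ln (avg Q v)"
    using t calculation(2) by simp
  ultimately have "- avg Q (\<lambda>x. ln (w x)) \<le> t * ln (avg Q v)"
    using t by simp
  then show "exp (avg Q (\<lambda>x. ln (inverse (w x)))) \<le> avg Q v powr t"
    using avg_pos[OF Q v(1) pos] set_integrable_ln_inverse_iff[OF w Q] by (simp add: powr_def)
qed

text \<open>If \<open>w\<close> is in \<open>Ap p\<close>, Jensen's inequality for the dual weight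
  bounds each term of the Hruscev supremum by the corresponding term of the \<open>Ap\<close>
  constant; for p = 1 the average of \<open>inverse w\<close> is in turn at most its essential
  supremum.\<close>

lemma hruscev_finite:
  assumes "w \<in> A_inf"
  shows "weight w" "hruscev w < \<infinity>"
proof -
  obtain p where p: "1 \<le> p" "w \<in> Ap p"
    using assms by (auto simp: A_inf_def)
  then show w: "weight w"
    by (simp add: Ap_def)
  note [measurable] = weight_measurable[OF w]
  let ?h = "\<lambda>Q. if set_integrable lebesgue Q (\<lambda>x. ln (inverse (w x)))
       then ennreal (avg Q w * exp (avg Q (\<lambda>x. ln (inverse (w x)))))
       else \<infinity>"
  have "hruscev w \<le> (if p = 1 then A1_const w else Ap_const p w)"
    unfolding hruscev_def
  proof (rule SUP_least)
    fix Q :: "(real^'a) set" assume Q: "Q \<in> cubes"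
    note [measurable] = cube_sets[OF Q]
    show "?h Q \<le> (if p = 1 then A1_const w else Ap_const p w)"
    proof (cases "p = 1")
      case True
      let ?B = "esssup (lebesgue_on Q) (\<lambda>x. ennreal (inverse (w x)))"
      have le: "ennreal (avg Q w) * ?B \<le> A1_const w"
        unfolding A1_const_def by (rule SUP_upper[OF Q])
      also have "\<dots> < \<infinity>"
        using p True by (simp add: Ap_def)
      \<comment> \<open>The average of \<open>w\<close> is positive, so an infinite essential
        supremum would make the product infinite.\<close>
      finally have "?B \<noteq> \<infinity>"
        using weight_avg_pos[OF w Q] by (auto simp: ennreal_mult_top)
      then obtain b where b: "0 \<le> b" "?B = ennreal b"
        by (cases ?B) auto
      have "AE x in lebesgue_on Q. ennreal (inverse (w x)) \<le> ennreal b"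
        using esssup_AE b(2) by metis
      then have AE_le: "AE x in lebesgue. x \<in> Q \<longrightarrow> inverse (w x) \<le> b"
        using b(1) by (subst (asm) AE_restrict_space_iff) (auto simp: ennreal_le_iff)
      have int: "set_integrable lebesgue Q (\<lambda>x. inverse (w x))"
      proof (rule set_integrable_bound)
        show "set_integrable lebesgue Q (\<lambda>x. b)"
          using Q by simp
        show "set_borel_measurable lebesgue Q (\<lambda>x. inverse (w x))"
          unfolding set_borel_measurable_def by measurable
        show "AE x\<in>Q in lebesgue. norm (inverse (w x)) \<le> norm b"
          using AE_le weight_pos[OF w] by eventually_elim auto
      qed
      have vw: "AE x in lebesgue. 0 < inverse (w x) \<and> 1 * ln (inverse (w x)) = - ln (w x)"
        using weight_pos[OF w] by eventually_elim (simp add: ln_inverse)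
      have pos: "0 < avg Q (\<lambda>x. inverse (w x))"
        by (rule avg_pos[OF Q int]) (use vw in auto)
      have "avg Q (\<lambda>x. inverse (w x)) \<le> avg Q (\<lambda>x. b)"
        by (rule avg_mono[OF int _ AE_le]) (use Q in auto)
      then have "exp (avg Q (\<lambda>x. ln (inverse (w x)))) \<le> b"
        using exp_avg_ln_le_dual[OF w Q _ int _ vw] pos Q by simp
      then have "ennreal (avg Q w * exp (avg Q (\<lambda>x. ln (inverse (w x))))) \<le> ennreal (avg Q w * b)"
        using weight_avg_pos[OF w Q] by (intro ennreal_leI mult_left_mono) auto
      also have "\<dots> = ennreal (avg Q w) * ?B"
        using b weight_avg_pos[OF w Q] by (simp add: ennreal_mult)
      finally show ?thesis
        using le integrable_ln_of_dual[OF w Q _ int _ vw] True by auto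
    next
      case False
      then have t: "0 < p - 1"
        using p by simp
      let ?v = "\<lambda>x. w x powr (1 - p / (p - 1))"
      have le: "(if set_integrable lebesgue Q ?v
          then ennreal (avg Q w * avg Q ?v powr (p - 1)) else \<infinity>) \<le> Ap_const p w"
        unfolding Ap_const_def Let_def by (rule SUP_upper[OF Q])
      moreover have "Ap_const p w < \<infinity>"
        using p False by (simp add: Ap_def)
      ultimately have int: "set_integrable lebesgue Q ?v"
        by (auto split: if_splits simp: top_unique)
      have vw: "AE x in lebesgue. 0 < ?v x \<and> (p - 1) * ln (?v x) = - ln (w x)"
        using weight_pos[OF w]
      proof eventually_elim
        case (elim x)
        have "(p - 1) * (1 - p / (p - 1)) = - 1"
          using t by (simp add: field_simps)
        then have "(p - 1) * ((1 - p / (p - 1)) * ln (w x)) = - 1 * ln (w x)"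
          by (simp only: mult.assoc[symmetric])
        then show ?case
          using elim by (simp add: ln_powr)
      qed
      have "exp (avg Q (\<lambda>x. ln (inverse (w x)))) \<le> avg Q ?v powr (p - 1)"
        by (rule exp_avg_ln_le_dual[OF w Q t int _ vw]) measurable
      then have "ennreal (avg Q w * exp (avg Q (\<lambda>x. ln (inverse (w x)))))
          \<le> ennreal (avg Q w * avg Q ?v powr (p - 1))"
        using weight_avg_pos[OF w Q] by (intro ennreal_leI mult_left_mono) auto
      then show ?thesis
        using le int integrable_ln_of_dual[OF w Q t int _ vw] False by auto
    qed
  qed
  also have "\<dots> < \<infinity>"
    using p by (auto simp: Ap_def)
  finally show "hruscev w < \<infinity>" .
qed

text \<open>For s = ln (w / c), |s| is - s plus twice the positive part of s, and that positive part
  is at most w / c. In mean, - s contributes at most ln H and 2 w / c contributes 2; the outer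
  factor 2 is the change of reference from \<open>ln c\<close> to the mean of
  \<open>ln w\<close>.\<close>

lemma avg_oscillation_ln_le_hruscev:
  assumes w: "weight w" and H: "hruscev w \<le> ennreal H" and Q: "Q \<in> cubes"
  shows "avg Q (\<lambda>x. \<bar>ln (w x) - avg Q (\<lambda>x. ln (w x))\<bar>) \<le> 2 * (ln H + 2)"
proof -
  let ?c = "avg Q w"
  have c: "0 < ?c"
    by (rule weight_avg_pos[OF w Q])
  note ln = hruscev_integrable[OF w H Q] and int = weight_integrable[OF w Q]
  have "avg Q (\<lambda>x. \<bar>ln (w x) - ln ?c\<bar>) \<le> avg Q (\<lambda>x. (ln ?c - ln (w x)) + (2 / ?c) * w x)"
  proof (rule avg_mono)
    show "AE x in lebesgue. x \<in> Q \<longrightarrow> \<bar>ln (w x) - ln ?c\<bar> \<le> (ln ?c - ln (w x)) + (2 / ?c) * w x"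
      using weight_pos[OF w]
    proof eventually_elim
      case (elim x)
      have "ln (w x / ?c) \<le> w x / ?c - 1"
        using elim c by (intro ln_le_minus_one) auto
      moreover have "ln (w x / ?c) = ln (w x) - ln ?c"
        using elim c by (simp add: ln_div)
      moreover have "0 < w x / ?c"
        using elim c by simp
      ultimately show ?case
        by auto
    qed
  qed (use Q ln int in \<open>auto intro!: set_integrable_abs\<close>)
  also have "\<dots> = ln ?c - avg Q (\<lambda>x. ln (w x)) + (2 / ?c) * ?c"
    using Q ln int by (simp add: avg_add avg_diff avg_cmult del: times_divide_eq_left)
  finally have "avg Q (\<lambda>x. \<bar>ln (w x) - ln ?c\<bar>) \<le> ln H + 2"
    using hruscev_avg_ln[OF w H Q] c by simp
  then show ?thesis
    by (intro order_trans[OF avg_abs_diff_avg_le[OF Q ln, of "ln ?c"]]) simp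
qed

section \<open>The maximal function and the Fujii-Wilson constant\<close>

lemma BMO_seminorm_leI:
  assumes "\<And>Q. Q \<in> cubes \<Longrightarrow> avg Q (\<lambda>x. \<bar>f x - avg Q f\<bar>) \<le> B"
  shows "BMO_seminorm f \<le> ennreal B"
  unfolding BMO_seminorm_def by (intro SUP_least ennreal_leI assms)

lemma avg_hcube_le_maximal:
  fixes b :: "real^'n"
  assumes "0 < m" "x \<in> hcube b m"
  shows "(\<integral>\<^sup>+y\<in>hcube b m. ennreal \<bar>f y\<bar> \<partial>lebesgue) / ennreal (m ^ CARD('n)) \<le> maximal f x"
proof -
  let ?Q = "cbox b (\<chi> i. b $ i + m)"
  have "?Q \<in> {Q \<in> cubes. x \<in> Q}"
    using assms hcube_subset_cbox by (auto simp: cubes_def)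
  then have "(\<integral>\<^sup>+y\<in>?Q. ennreal \<bar>f y\<bar> \<partial>lebesgue) / ennreal (measure lebesgue ?Q) \<le> maximal f x"
    unfolding maximal_def by (rule SUP_upper)
  then show ?thesis
    using assms(1) measure_cbox_cube[of m b] by (simp only: nn_integral_hcube_eq_cbox less_imp_le)
qed

text \<open>The measurable \<open>g\<close> stands in for the maximal function. On a small cube
  inside \<open>U\<close> it is the average of |f| over that cube, on a small cube missing
  \<open>K\<close> it is \<open>c\<close>; larger cubes inherit it from their children. The term on
  \<open>U - G\<close> pays for the points of cubes inside \<open>U\<close> where |f| may fall below
  \<open>c\<close>.\<close>

lemma maximal_minorant:
  fixes f :: "real^'n \<Rightarrow> real" and a :: "real^'n"
  assumes [measurable]: "f \<in> borel_measurable lebesgue" "G \<in> sets lebesgue"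
    and KGU: "compact K" "K \<subseteq> G" "G \<subseteq> U" "open U"
    and G: "\<And>x. x \<in> G \<Longrightarrow> c \<le> ennreal \<bar>f x\<bar>"
    and "0 < l" "\<And>x. x \<in> hcube a l \<Longrightarrow> c \<le> maximal f x"
  shows "\<exists>g\<in>borel_measurable lebesgue. (\<forall>x\<in>hcube a l. g x \<le> maximal f x) \<and>
    (\<integral>\<^sup>+x\<in>hcube a l. (if x \<in> K then ennreal \<bar>f x\<bar> else c) \<partial>lebesgue)
      \<le> (\<integral>\<^sup>+x\<in>hcube a l. (g x + c * indicator (U - G) x) \<partial>lebesgue)"
proof -
  have [measurable]: "K \<in> sets lebesgue" "U \<in> sets lebesgue"
    using KGU by (auto simp: borel_compact)
  obtain \<epsilon> where \<epsilon>: "0 < \<epsilon>" "\<And>a l. l < \<epsilon> \<Longrightarrow> hcube a l \<subseteq> U \<or> hcube a l \<inter> K = {}"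
    using small_hcube_dichotomy[OF KGU(1,4)] KGU by blast
  let ?lhs = "\<lambda>x. if x \<in> K then ennreal \<bar>f x\<bar> else c"
  let ?h = "\<lambda>x. c * indicator (U - G) x"
  let ?P = "\<lambda>a l. \<exists>g\<in>borel_measurable lebesgue. (\<forall>x\<in>hcube a l. g x \<le> maximal f x) \<and>
    (\<integral>\<^sup>+x\<in>hcube a l. ?lhs x \<partial>lebesgue) \<le> (\<integral>\<^sup>+x\<in>hcube a l. (g x + ?h x) \<partial>lebesgue)"
  have "(\<forall>x\<in>hcube a l. c \<le> maximal f x) \<longrightarrow> ?P a l"
    using \<open>0 < l\<close> \<epsilon>(1)
  proof (induction rule: hcube_induct)
    case (small a l)
    show ?case
    proof
      assume c: "\<forall>x\<in>hcube a l. c \<le> maximal f x"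
      from \<epsilon>(2)[OF small(2), of a] show "?P a l"
      proof
        assume U: "hcube a l \<subseteq> U"
        let ?I = "\<integral>\<^sup>+x\<in>hcube a l. ennreal \<bar>f x\<bar> \<partial>lebesgue"
        let ?m = "ennreal (l ^ CARD('n))"
        have m: "?m \<noteq> 0" "?m \<noteq> \<infinity>"
          using small by auto
        have "(\<integral>\<^sup>+x\<in>hcube a l. ?lhs x \<partial>lebesgue) \<le> (\<integral>\<^sup>+x\<in>hcube a l. (ennreal \<bar>f x\<bar> + ?h x) \<partial>lebesgue)"
        proof (intro nn_integral_mono)
          fix x
          show "?lhs x * indicator (hcube a l) x \<le> (ennreal \<bar>f x\<bar> + ?h x) * indicator (hcube a l) x"
            using U G[of x] by (auto simp: indicator_def add_increasing2)
        qed
        also have "\<dots> = ?I + (\<integral>\<^sup>+x\<in>hcube a l. ?h x \<partial>lebesgue)"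
          by (simp add: distrib_right nn_integral_add)
        \<comment> \<open>Replacing |f| by its average over the cube preserves the integral, and
          that constant lies below the maximal function at every point of the cube.\<close>
        also have "?I = (\<integral>\<^sup>+x\<in>hcube a l. (?I / ?m) \<partial>lebesgue)"
        proof -
          have "(\<integral>\<^sup>+x\<in>hcube a l. (?I / ?m) \<partial>lebesgue) = ?I / ?m * emeasure lebesgue (hcube a l)"
            by (rule nn_integral_cmult_indicator) measurable
          also have "\<dots> = ?I / ?m * ?m"
            using small emeasure_hcube[of l a] by (simp del: emeasure_completion)
          also have "\<dots> = ?I"
            using m by (simp add: ennreal_divide_times ennreal_divide_self less_top)
          finally show ?thesis ..
        qed
        also have "\<dots> + (\<integral>\<^sup>+x\<in>hcube a l. ?h x \<partial>lebesgue) = (\<integral>\<^sup>+x\<in>hcube a l. (?I / ?m + ?h x) \<partial>lebesgue)"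
          by (simp add: distrib_right nn_integral_add)
        finally show ?thesis
          using avg_hcube_le_maximal[OF small(1)] by (intro bexI[of _ "\<lambda>x. ?I / ?m"] conjI ballI) simp_all
      next
        assume "hcube a l \<inter> K = {}"
        then have "(\<integral>\<^sup>+x\<in>hcube a l. ?lhs x \<partial>lebesgue) \<le> (\<integral>\<^sup>+x\<in>hcube a l. (c + ?h x) \<partial>lebesgue)"
          by (intro nn_integral_mono) (auto simp: indicator_def)
        then show ?thesis
          using c by (intro bexI[of _ "\<lambda>x. c"] conjI) simp_all
      qed
    qed
  next
    case (corners a l)
    show ?case
    proof
      assume "\<forall>x\<in>hcube a l. c \<le> maximal f x"
      then have *: "?P (corner a l \<sigma>) (l / 2)" for \<sigma>
        using corners(2)[of \<sigma>] hcube_corner_subset[OF corners(1), of a \<sigma>] by blast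
      define R where "R \<sigma> g \<longleftrightarrow> g \<in> borel_measurable lebesgue \<and>
          (\<forall>x\<in>hcube (corner a l \<sigma>) (l / 2). g x \<le> maximal f x) \<and>
          (\<integral>\<^sup>+x\<in>hcube (corner a l \<sigma>) (l / 2). ?lhs x \<partial>lebesgue)
             \<le> (\<integral>\<^sup>+x\<in>hcube (corner a l \<sigma>) (l / 2). (g x + ?h x) \<partial>lebesgue)" for \<sigma> g
      have "\<exists>g. R \<sigma> g" for \<sigma>
        using * unfolding R_def by blast
      then obtain g where R: "R \<sigma> (g \<sigma>)" for \<sigma>
        by metis
      have [measurable]: "g \<sigma> \<in> borel_measurable lebesgue" for \<sigma>
        using R by (simp add: R_def)
      have g: "x \<in> hcube (corner a l \<sigma>) (l / 2) \<Longrightarrow> g \<sigma> x \<le> maximal f x"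
          "(\<integral>\<^sup>+x\<in>hcube (corner a l \<sigma>) (l / 2). ?lhs x \<partial>lebesgue)
             \<le> (\<integral>\<^sup>+x\<in>hcube (corner a l \<sigma>) (l / 2). (g \<sigma> x + ?h x) \<partial>lebesgue)" for \<sigma> x
        using R[of \<sigma>] by (auto simp: R_def)
      \<comment> \<open>The children are disjoint, so at each point at most one summand
        survives.\<close>
      define g' where "g' x = (\<Sum>\<sigma>\<in>UNIV. g \<sigma> x * indicator (hcube (corner a l \<sigma>) (l / 2)) x)" for x
      have [measurable]: "g' \<in> borel_measurable lebesgue"
        unfolding g'_def by measurable
      have g': "g' x = g \<sigma> x" if "x \<in> hcube (corner a l \<sigma>) (l / 2)" for x \<sigma>
      proof -
        have "g' x = (\<Sum>\<tau>\<in>UNIV. if \<tau> = \<sigma> then g \<tau> x else 0)"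
          unfolding g'_def using that
          by (intro sum.cong) (auto simp: mem_hcube_corner[OF corners(1)])
        then show ?thesis
          by simp
      qed
      have "(\<integral>\<^sup>+x\<in>hcube a l. ?lhs x \<partial>lebesgue)
          = (\<Sum>\<sigma>\<in>UNIV. \<integral>\<^sup>+x\<in>hcube (corner a l \<sigma>) (l / 2). ?lhs x \<partial>lebesgue)"
        by (rule nn_integral_hcube_corners[OF corners(1)]) measurable
      also have "\<dots> \<le> (\<Sum>\<sigma>\<in>UNIV. \<integral>\<^sup>+x\<in>hcube (corner a l \<sigma>) (l / 2). (g \<sigma> x + ?h x) \<partial>lebesgue)"
        by (intro sum_mono g)
      also have "\<dots> = (\<Sum>\<sigma>\<in>UNIV. \<integral>\<^sup>+x\<in>hcube (corner a l \<sigma>) (l / 2). (g' x + ?h x) \<partial>lebesgue)"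
        by (intro sum.cong nn_integral_cong) (auto simp: indicator_def g')
      also have "\<dots> = (\<integral>\<^sup>+x\<in>hcube a l. (g' x + ?h x) \<partial>lebesgue)"
        by (rule nn_integral_hcube_corners[OF corners(1), symmetric]) measurable
      finally have "(\<integral>\<^sup>+x\<in>hcube a l. ?lhs x \<partial>lebesgue) \<le> \<dots>" .
      moreover have "g' x \<le> maximal f x" if "x \<in> hcube a l" for x
      proof -
        have "x \<in> hcube (corner a l {i. a $ i + l / 2 \<le> x $ i}) (l / 2)"
          using that by (simp add: mem_hcube_corner[OF corners(1)])
        then show ?thesis
          using g(1) g' by metis
      qed
      ultimately show "?P a l"
        by (intro bexI[of _ g'] conjI ballI) simp_all
    qed
  qed
  then show ?thesis
    by (rule mp) (simp add: assms(9))
qed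

text \<open>Integrated form of the lower bound max(w, w_Q) for the maximal function. For a compact
  \<open>K\<close> inside the set where w > w_Q it follows from \<open>maximal_minorant\<close>, up
  to an error that outer regularity makes arbitrarily small; exhausting that set by compact sets
  then gives the claim.\<close>

lemma nn_integral_excess_le_maximal:
  fixes w :: "real^'n \<Rightarrow> real"
  assumes w: "weight w" and Q: "Q \<in> cubes"
  shows "ennreal (measure lebesgue Q * avg Q w) +
      (\<integral>\<^sup>+x\<in>{x \<in> Q. avg Q w < w x}. ennreal (w x - avg Q w) \<partial>lebesgue)
    \<le> (\<integral>\<^sup>+x\<in>Q. maximal (\<lambda>y. w y * indicator Q y) x \<partial>lebesgue)" (is "_ + ?J \<le> ?M")
proof -
  note [measurable] = weight_measurable[OF w] cube_sets[OF Q]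
  obtain a l where al: "0 < l" "Q = cbox a (\<chi> i. a $ i + l)"
    using Q by (rule cubesE)
  let ?c = "avg Q w" and ?f = "\<lambda>y. w y * indicator Q y"
  have c: "0 < ?c"
    by (rule weight_avg_pos[OF w Q])
  define G where "G = {x \<in> Q. ?c < w x}"
  have [measurable]: "G \<in> sets lebesgue"
    unfolding G_def by measurable
  have mQ: "measure lebesgue Q = l ^ CARD('n)"
    using al measure_cbox_cube[of l a] by simp
  have wQ: "(\<integral>\<^sup>+y\<in>hcube a l. ennreal \<bar>?f y\<bar> \<partial>lebesgue) = ennreal (measure lebesgue Q * ?c)"
  proof -
    have "(\<integral>\<^sup>+y\<in>hcube a l. ennreal \<bar>?f y\<bar> \<partial>lebesgue) = (\<integral>\<^sup>+y\<in>Q. ennreal (w y) \<partial>lebesgue)"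
      unfolding nn_integral_hcube_eq_cbox al(2)[symmetric]
      by (rule nn_integral_cong_AE, rule eventually_mono[OF weight_pos[OF w]]) (auto simp: indicator_def)
    also have "\<dots> = ennreal (measure lebesgue Q * ?c)"
      by (rule nn_integral_eq_avg[OF Q weight_integrable[OF w Q]])
         (rule eventually_mono[OF weight_pos[OF w]], simp)
    finally show ?thesis .
  qed
  \<comment> \<open>\<open>Q\<close> itself competes in the supremum at each of its points.\<close>
  have c_le: "ennreal ?c \<le> maximal ?f x" if "x \<in> hcube a l" for x
    using avg_hcube_le_maximal[OF al(1) that, of ?f] c al(1) unfolding wQ mQ
    by (simp add: divide_ennreal)
  have "ennreal (measure lebesgue Q * ?c) + (\<integral>\<^sup>+x\<in>K. ennreal (w x - ?c) \<partial>lebesgue) \<le> ?M"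
    if K: "compact K" "K \<subseteq> G" for K
  proof (rule ennreal_le_epsilon)
    fix e :: real assume e: "0 < e"
    have [measurable]: "K \<in> sets lebesgue"
      using K by (simp add: borel_compact)
    \<comment> \<open>The error in \<open>maximal_minorant\<close> is at most \<open>?c\<close>
      times the measure of \<open>U - G\<close>, hence the tolerance \<open>e / ?c\<close>.\<close>
    have "0 < e / ?c"
      using e c by simp
    then obtain U where U: "open U" "G \<subseteq> U" "emeasure lebesgue (U - G) < ennreal (e / ?c)"
      using sets_lebesgue_outer_open[OF \<open>G \<in> sets lebesgue\<close>] by metis
    then have [measurable]: "U \<in> sets lebesgue"
      by simp
    have f: "?f \<in> borel_measurable lebesgue"
      by measurable
    have c_le_f: "ennreal ?c \<le> ennreal \<bar>?f x\<bar>" if "x \<in> G" for x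
      using that by (auto simp: G_def intro!: ennreal_leI)
    obtain g where [measurable]: "g \<in> borel_measurable lebesgue"
      and g: "\<And>x. x \<in> hcube a l \<Longrightarrow> g x \<le> maximal ?f x"
        "(\<integral>\<^sup>+x\<in>hcube a l. (if x \<in> K then ennreal \<bar>?f x\<bar> else ennreal ?c) \<partial>lebesgue)
          \<le> (\<integral>\<^sup>+x\<in>hcube a l. (g x + ennreal ?c * indicator (U - G) x) \<partial>lebesgue)"
      using maximal_minorant[OF f \<open>G \<in> sets lebesgue\<close> K U(2,1) c_le_f al(1) c_le] by blast
    have "(\<integral>\<^sup>+x\<in>Q. ennreal ?c \<partial>lebesgue) = ennreal ?c * emeasure lebesgue Q"
      by (rule nn_integral_cmult_indicator) measurable
    also have "\<dots> = ennreal (measure lebesgue Q * ?c)"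
      using c emeasure_cube[OF Q] by (simp add: ennreal_mult mult.commute del: emeasure_completion)
    finally have "ennreal (measure lebesgue Q * ?c) + (\<integral>\<^sup>+x\<in>K. ennreal (w x - ?c) \<partial>lebesgue)
       = (\<integral>\<^sup>+x\<in>Q. ennreal ?c \<partial>lebesgue) + (\<integral>\<^sup>+x\<in>K. ennreal (w x - ?c) \<partial>lebesgue)"
      by simp
    also have "\<dots> = (\<integral>\<^sup>+x. (ennreal ?c * indicator Q x + ennreal (w x - ?c) * indicator K x) \<partial>lebesgue)"
      by (simp add: nn_integral_add)
    also have "\<dots> = (\<integral>\<^sup>+x\<in>Q. (if x \<in> K then ennreal \<bar>?f x\<bar> else ennreal ?c) \<partial>lebesgue)"
      using K(2) c by (intro nn_integral_cong) (auto simp: indicator_def G_def ennreal_plus[symmetric] simp del: ennreal_plus)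
    also have "\<dots> \<le> (\<integral>\<^sup>+x\<in>hcube a l. (g x + ennreal ?c * indicator (U - G) x) \<partial>lebesgue)"
      using g(2) by (simp only: nn_integral_hcube_eq_cbox al(2)[symmetric])
    also have "\<dots> = (\<integral>\<^sup>+x\<in>hcube a l. g x \<partial>lebesgue) + (\<integral>\<^sup>+x\<in>hcube a l. ennreal ?c * indicator (U - G) x \<partial>lebesgue)"
      by (simp add: distrib_right nn_integral_add)
    also have "\<dots> \<le> ?M + ennreal e"
    proof (rule add_mono)
      have "(\<integral>\<^sup>+x\<in>hcube a l. g x \<partial>lebesgue) \<le> (\<integral>\<^sup>+x\<in>hcube a l. maximal ?f x \<partial>lebesgue)"
        using g(1) by (intro nn_integral_mono) (auto simp: indicator_def)
      also have "\<dots> = ?M"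
        unfolding nn_integral_hcube_eq_cbox al(2)[symmetric] ..
      finally show "(\<integral>\<^sup>+x\<in>hcube a l. g x \<partial>lebesgue) \<le> ?M" .
      have "(\<integral>\<^sup>+x\<in>hcube a l. ennreal ?c * indicator (U - G) x \<partial>lebesgue)
          \<le> (\<integral>\<^sup>+x. ennreal ?c * indicator (U - G) x \<partial>lebesgue)"
        by (intro nn_integral_mono) (auto simp: indicator_def)
      also have "\<dots> = ennreal ?c * emeasure lebesgue (U - G)"
        by (rule nn_integral_cmult_indicator) measurable
      also have "\<dots> \<le> ennreal ?c * ennreal (e / ?c)"
        using U(3) by (intro mult_left_mono) auto
      also have "\<dots> = ennreal e"
        using c e by (simp add: ennreal_mult[symmetric])
      finally show "(\<integral>\<^sup>+x\<in>hcube a l. ennreal ?c * indicator (U - G) x \<partial>lebesgue) \<le> ennreal e" .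
    qed
    finally show "ennreal (measure lebesgue Q * ?c) + (\<integral>\<^sup>+x\<in>K. ennreal (w x - ?c) \<partial>lebesgue) \<le> ?M + ennreal e" .
  qed
  note bound = this
  have "(\<integral>\<^sup>+x\<in>G. ennreal (w x - ?c) \<partial>lebesgue) \<le> ?M - ennreal (measure lebesgue Q * ?c)"
  proof (rule nn_integral_le_of_compact_subsets)
    fix K assume "compact K" "K \<subseteq> G"
    from bound[OF this] show "(\<integral>\<^sup>+x\<in>K. ennreal (w x - ?c) \<partial>lebesgue) \<le> ?M - ennreal (measure lebesgue Q * ?c)"
      by (subst ennreal_le_minus_iff) (simp add: add.commute)
  qed auto
  then have "ennreal (measure lebesgue Q * ?c) + (\<integral>\<^sup>+x\<in>G. ennreal (w x - ?c) \<partial>lebesgue)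
      \<le> ennreal (measure lebesgue Q * ?c) + (?M - ennreal (measure lebesgue Q * ?c))"
    by (rule add_left_mono)
  \<comment> \<open>The empty compact set in \<open>bound\<close> shows that the subtracted term is
    at most \<open>?M\<close>, so adding it back undoes the truncated subtraction.\<close>
  also have "\<dots> = ?M"
    using bound[of "{}"] by (simp add: add_diff_self_ennreal)
  finally show ?thesis
    unfolding G_def .
qed

text \<open>The full integral of \<open>w\<close> over \<open>Q\<close>, the first term in
  \<open>nn_integral_excess_le_maximal\<close>, accounts for 1 in \<open>F\<close>; what remains
  bounds the excess.\<close>

lemma avg_excess_le_fujii_wilson:
  assumes w: "weight w" and F: "fujii_wilson w \<le> ennreal F" and Q: "Q \<in> cubes"
  shows "avg Q (\<lambda>x. max 0 (w x - avg Q w)) \<le> (F - 1) * avg Q w"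
proof -
  note [measurable] = weight_measurable[OF w] cube_sets[OF Q]
  let ?c = "avg Q w" and ?m = "measure lebesgue Q"
  let ?M = "\<integral>\<^sup>+x\<in>Q. maximal (\<lambda>y. w y * indicator Q y) x \<partial>lebesgue"
  have c: "0 < ?c" and m: "0 < ?m"
    using weight_avg_pos[OF w Q] cube_measure_pos[OF Q] by auto
  have int: "set_integrable lebesgue Q (\<lambda>x. max 0 (w x - ?c))"
    using Q weight_integrable[OF w Q] by (intro set_integrable_max_0) auto
  have LINT: "(LINT x:Q|lebesgue. w x) = ?m * ?c"
    using m by (simp add: avg_def)
  have avg_nonneg: "0 \<le> avg Q (\<lambda>x. max 0 (w x - ?c))"
    using avg_mono[of Q "\<lambda>x. 0" "\<lambda>x. max 0 (w x - ?c)"] int Q by simp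
  have "?M / ennreal (LINT x:Q|lebesgue. w x) \<le> fujii_wilson w"
    unfolding fujii_wilson_def by (rule SUP_upper[OF Q])
  then have "?M / ennreal (?m * ?c) \<le> ennreal F"
    unfolding LINT using F by (rule order_trans)
  then have "?M / ennreal (?m * ?c) * ennreal (?m * ?c) \<le> ennreal F * ennreal (?m * ?c)"
    by (rule mult_right_mono) simp
  moreover have "?M / ennreal (?m * ?c) * ennreal (?m * ?c) = ?M"
    using c m by (simp add: ennreal_divide_times ennreal_divide_self)
  ultimately have "?M \<le> ennreal F * ennreal (?m * ?c)"
    by simp
  moreover have "(\<integral>\<^sup>+x\<in>{x \<in> Q. ?c < w x}. ennreal (w x - ?c) \<partial>lebesgue)
      = (\<integral>\<^sup>+x\<in>Q. ennreal (max 0 (w x - ?c)) \<partial>lebesgue)"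
    by (intro nn_integral_cong) (auto simp: indicator_def max_def)
  moreover have "\<dots> = ennreal (?m * avg Q (\<lambda>x. max 0 (w x - ?c)))"
    by (rule nn_integral_eq_avg[OF Q int]) simp
  ultimately have "ennreal (?m * ?c) + ennreal (?m * avg Q (\<lambda>x. max 0 (w x - ?c)))
      \<le> ennreal F * ennreal (?m * ?c)"
    using nn_integral_excess_le_maximal[OF w Q] by simp
  then have le: "ennreal (?m * ?c + ?m * avg Q (\<lambda>x. max 0 (w x - ?c))) \<le> ennreal (F * (?m * ?c))"
    using c m avg_nonneg by (simp add: ennreal_mult'' ennreal_plus)
  \<comment> \<open>\<open>ennreal\<close> sends negative reals to 0 and the sign of
    \<open>F\<close> is still unknown; positivity of the left side makes the comparison in
    \<open>le\<close> one of reals.\<close>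
  have "0 < ?m * ?c + ?m * avg Q (\<lambda>x. max 0 (w x - ?c))"
    using c m avg_nonneg by (simp add: add_pos_nonneg)
  with le have "?m * ?c + ?m * avg Q (\<lambda>x. max 0 (w x - ?c)) \<le> F * (?m * ?c)"
    by (metis ennreal_le_iff2 linorder_not_less)
  then have "?m * avg Q (\<lambda>x. max 0 (w x - ?c)) \<le> ?m * ((F - 1) * ?c)"
    by (simp add: algebra_simps)
  then show ?thesis
    using m by simp
qed

section \<open>The logarithmic tail and the stopping time\<close>

lemma avg_ge_of_mostly_ge:
  fixes a :: "real^'n"
  assumes w: "weight w" and "0 < l" "0 \<le> c" and [measurable]: "U \<in> sets lebesgue"
    and U: "emeasure lebesgue (hcube a l \<inter> U) \<le> ennreal (l ^ CARD('n) / 2)"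
    and ge: "\<And>x. x \<in> hcube a l - U \<Longrightarrow> c \<le> w x"
  shows "c / 2 \<le> avg (cbox a (\<chi> i. a $ i + l)) w"
proof -
  let ?S = "cbox a (\<chi> i. a $ i + l)" and ?R = "hcube a l" and ?m = "l ^ CARD('n)"
  have S: "?S \<in> cubes"
    using \<open>0 < l\<close> by (auto simp: cubes_def)
  have mS: "measure lebesgue ?S = ?m"
    by (rule measure_cbox_cube) (use \<open>0 < l\<close> in simp)
  have R: "emeasure lebesgue ?R = ennreal ?m"
    by (rule emeasure_hcube) (use \<open>0 < l\<close> in simp)
  have "ennreal (?m / 2) = ennreal ?m - ennreal (?m / 2)"
    using \<open>0 < l\<close> by (subst ennreal_minus) auto
  also have "\<dots> \<le> emeasure lebesgue ?R - emeasure lebesgue (?R \<inter> U)"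
    unfolding R by (rule ennreal_minus_mono[OF order_refl U])
  also have "\<dots> = emeasure lebesgue (?R - ?R \<inter> U)"
    by (rule emeasure_Diff[symmetric]) (use U in \<open>auto simp: top_unique\<close>)
  also have "?R - ?R \<inter> U = ?R - U"
    by blast
  finally have "ennreal c * ennreal (?m / 2) \<le> ennreal c * emeasure lebesgue (?R - U)"
    by (rule mult_left_mono) simp
  also have "\<dots> = (\<integral>\<^sup>+x. ennreal c * indicator (?R - U) x \<partial>lebesgue)"
    by (rule nn_integral_cmult_indicator[symmetric]) measurable
  also have "\<dots> \<le> (\<integral>\<^sup>+x\<in>?S. ennreal (w x) \<partial>lebesgue)"
    using ge hcube_subset_cbox[of a l] by (intro nn_integral_mono) (auto simp: indicator_def intro!: ennreal_leI)
  also have "\<dots> = ennreal (?m * avg ?S w)"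
    unfolding mS[symmetric]
    by (rule nn_integral_eq_avg[OF S weight_integrable[OF w S]])
       (rule eventually_mono[OF weight_pos[OF w]], simp)
  finally have "ennreal (c * (?m / 2)) \<le> ennreal (?m * avg ?S w)"
    using \<open>0 \<le> c\<close> by (simp only: ennreal_mult')
  then have "c * (?m / 2) \<le> ?m * avg ?S w"
    using weight_avg_pos[OF w S] \<open>0 < l\<close> by (subst (asm) ennreal_le_iff) auto
  then have "?m * (c / 2) \<le> ?m * avg ?S w"
    by (simp add: mult.commute)
  then show ?thesis
    using \<open>0 < l\<close> by simp
qed

text \<open>The level \<open>c\<close> is raised to d = 4 * avg Q w, which costs ln 4 relative to
  the average. Adding w / d, of mean 1 / 4, makes ln d - ln w non-negative because ln (w / d) <= w /
  d - 1; so it dominates the integrand, which \<open>ennreal\<close> truncates at 0, and its mean is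
  controlled by ln H.\<close>

lemma nn_integral_ln_deficit_le:
  assumes w: "weight w" and H: "hruscev w \<le> ennreal H" and Q: "Q \<in> cubes"
    and c: "0 < c" "c / 4 \<le> avg Q w"
  shows "(\<integral>\<^sup>+x\<in>Q. ennreal (ln c - ln (w x)) \<partial>lebesgue)
    \<le> ennreal ((ln 4 + ln H + 1) * measure lebesgue Q)"
proof -
  let ?d = "4 * avg Q w"
  have d: "0 < ?d" "c \<le> ?d"
    using c by auto
  note ln = hruscev_integrable[OF w H Q] and int = weight_integrable[OF w Q]
  have intd: "set_integrable lebesgue Q (\<lambda>x. (ln ?d - ln (w x)) + (1 / ?d) * w x)"
    using Q ln int by (intro set_integral_add set_integral_diff set_integrable_mult_right) auto
  have le: "AE x in lebesgue. max 0 (ln c - ln (w x)) \<le> (ln ?d - ln (w x)) + (1 / ?d) * w x"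
    using weight_pos[OF w]
  proof eventually_elim
    case (elim x)
    have "ln (w x / ?d) \<le> w x / ?d - 1"
      using elim d by (intro ln_le_minus_one) auto
    moreover have "ln (w x / ?d) = ln (w x) - ln ?d"
      using elim d by (subst ln_div) auto
    moreover have "ln c \<le> ln ?d"
      using c d by simp
    moreover have "0 < (1 / ?d) * w x" "(1 / ?d) * w x = w x / ?d"
      using elim d by auto
    ultimately show ?case
      by linarith
  qed
  have "(\<integral>\<^sup>+x\<in>Q. ennreal (ln c - ln (w x)) \<partial>lebesgue)
      \<le> (\<integral>\<^sup>+x\<in>Q. ennreal ((ln ?d - ln (w x)) + (1 / ?d) * w x) \<partial>lebesgue)"
    by (rule nn_integral_mono_AE, rule eventually_mono[OF le])
       (auto simp: indicator_def intro!: ennreal_leI)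
  also have "\<dots> = ennreal (measure lebesgue Q * avg Q (\<lambda>x. (ln ?d - ln (w x)) + (1 / ?d) * w x))"
    by (rule nn_integral_eq_avg[OF Q intd], rule eventually_mono[OF le]) simp
  also have "avg Q (\<lambda>x. (ln ?d - ln (w x)) + (1 / ?d) * w x) = ln ?d - avg Q (\<lambda>x. ln (w x)) + (1 / ?d) * avg Q w"
    using Q ln int by (simp add: avg_add avg_diff avg_cmult set_integral_diff del: times_divide_eq_left)
  also have "(1 / ?d) * avg Q w = 1 / 4"
    using d by simp
  also have "ln ?d = ln 4 + ln (avg Q w)"
    using d by (intro ln_mult_pos) auto
  also have "ennreal (measure lebesgue Q * (ln 4 + ln (avg Q w) - avg Q (\<lambda>x. ln (w x)) + 1 / 4))
      \<le> ennreal (measure lebesgue Q * (ln 4 + ln H + 1))"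
    using hruscev_avg_ln[OF w H Q] by (intro ennreal_leI mult_left_mono) auto
  finally show ?thesis
    by (simp add: mult.commute)
qed

(* A cube is stopped as soon as U fills more than the fraction 1 / N of it. Its parent was not
   stopped, so U fills at most 2^n / N = 1 / 2 of the cube; hence the average of w over it is still
   at least c / 4, and the Hruscev constant controls the whole cube. *)
lemma nn_integral_ln_deficit_stopping:
  fixes w :: "real^'n \<Rightarrow> real" and a :: "real^'n"
  defines "N \<equiv> 2 ^ (CARD('n) + 1)"
  assumes w: "weight w" and H: "hruscev w \<le> ennreal H" and c: "0 < c"
    and KU: "compact K" "open U" "K \<subseteq> U"
    and ge: "\<And>x. x \<in> Q - U \<Longrightarrow> c / 2 \<le> w x"
    and "0 < l" "hcube a l \<subseteq> Q" "emeasure lebesgue (hcube a l \<inter> U) \<le> ennreal (l ^ CARD('n) / N)"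
  shows "(\<integral>\<^sup>+x\<in>hcube a l. (ennreal (ln c - ln (w x)) * indicator K x) \<partial>lebesgue)
    \<le> (\<integral>\<^sup>+x\<in>hcube a l. (ennreal (N * (ln 4 + ln H + 1)) * indicator U x) \<partial>lebesgue)"
proof -
  let ?C = "ln 4 + ln H + 1"
  have [measurable]: "K \<in> sets lebesgue" "U \<in> sets lebesgue"
    using KU by (auto simp: borel_compact)
  note [measurable] = weight_measurable[OF w]
  have N: "1 < N"
    unfolding N_def by (rule one_less_power) auto
  obtain \<epsilon> where \<epsilon>: "0 < \<epsilon>" "\<And>a l. l < \<epsilon> \<Longrightarrow> hcube a l \<subseteq> U \<or> hcube a l \<inter> K = {}"
    using small_hcube_dichotomy[OF KU] by blast
  have "hcube a l \<subseteq> Q \<and> emeasure lebesgue (hcube a l \<inter> U) \<le> ennreal (l ^ CARD('n) / N) \<longrightarrow>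
    (\<integral>\<^sup>+x\<in>hcube a l. (ennreal (ln c - ln (w x)) * indicator K x) \<partial>lebesgue)
      \<le> (\<integral>\<^sup>+x\<in>hcube a l. (ennreal (N * ?C) * indicator U x) \<partial>lebesgue)"
    using \<open>0 < l\<close> \<epsilon>(1)
  proof (induction rule: hcube_induct)
    case (small a l)
    show ?case
    proof
      assume *: "hcube a l \<subseteq> Q \<and> emeasure lebesgue (hcube a l \<inter> U) \<le> ennreal (l ^ CARD('n) / N)"
      \<comment> \<open>A cube inside \<open>U\<close> would be filled completely, contradicting a
        filling of at most 1 / N with N > 1. So a small cube that was never stopped misses
        \<open>K\<close> and contributes nothing.\<close>
      have "\<not> hcube a l \<subseteq> U"
      proof
        assume "hcube a l \<subseteq> U"
        then have "hcube a l \<inter> U = hcube a l"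
          by blast
        then have "ennreal (l ^ CARD('n)) \<le> ennreal (l ^ CARD('n) / N)"
          using * small emeasure_hcube[of l a] by (simp del: emeasure_completion)
        then have "l ^ CARD('n) \<le> l ^ CARD('n) / N"
          using small N by (subst (asm) ennreal_le_iff) auto
        moreover have "l ^ CARD('n) / N < l ^ CARD('n) / 1"
          using small N by (intro divide_strict_left_mono) auto
        ultimately show False
          by simp
      qed
      then have "hcube a l \<inter> K = {}"
        using \<epsilon>(2)[OF small(2)] by blast
      then have "(\<integral>\<^sup>+x\<in>hcube a l. (ennreal (ln c - ln (w x)) * indicator K x) \<partial>lebesgue)
          = (\<integral>\<^sup>+x. 0 \<partial>(lebesgue :: (real^'n) measure))"
        by (intro nn_integral_cong) (auto simp: indicator_def)
      then show "(\<integral>\<^sup>+x\<in>hcube a l. (ennreal (ln c - ln (w x)) * indicator K x) \<partial>lebesgue)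
          \<le> (\<integral>\<^sup>+x\<in>hcube a l. (ennreal (N * ?C) * indicator U x) \<partial>lebesgue)"
        by simp
    qed
  next
    case (corners a l)
    show ?case
    proof
      assume *: "hcube a l \<subseteq> Q \<and> emeasure lebesgue (hcube a l \<inter> U) \<le> ennreal (l ^ CARD('n) / N)"
      have "(\<integral>\<^sup>+x\<in>hcube (corner a l \<sigma>) (l / 2). (ennreal (ln c - ln (w x)) * indicator K x) \<partial>lebesgue)
          \<le> (\<integral>\<^sup>+x\<in>hcube (corner a l \<sigma>) (l / 2). (ennreal (N * ?C) * indicator U x) \<partial>lebesgue)" for \<sigma>
      proof (cases "emeasure lebesgue (hcube (corner a l \<sigma>) (l / 2) \<inter> U) \<le> ennreal ((l / 2) ^ CARD('n) / N)")
        case True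
        then show ?thesis
          using corners(2)[of \<sigma>] * hcube_corner_subset[OF corners(1), of a \<sigma>] by blast
      next
        case False
        let ?R = "hcube (corner a l \<sigma>) (l / 2)" and ?m = "(l / 2) ^ CARD('n)"
        let ?S = "cbox (corner a l \<sigma>) (\<chi> i. corner a l \<sigma> $ i + l / 2)"
        have sub: "?R \<subseteq> hcube a l"
          by (rule hcube_corner_subset[OF corners(1)])
        have S: "?S \<in> cubes"
          using corners(1) by (auto simp: cubes_def intro!: exI[of _ "corner a l \<sigma>"] exI[of _ "l / 2"])
        have mS: "measure lebesgue ?S = ?m"
          by (rule measure_cbox_cube) (use corners(1) in simp)
        have "emeasure lebesgue (?R \<inter> U) \<le> emeasure lebesgue (hcube a l \<inter> U)"
          using sub by (intro emeasure_mono) auto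
        also have "\<dots> \<le> ennreal (l ^ CARD('n) / N)"
          using * by simp
        also have "l ^ CARD('n) / N = ?m / 2"
          by (simp add: N_def power_divide)
        finally have "c / 2 / 2 \<le> avg ?S w"
          using corners(1) c ge * sub by (intro avg_ge_of_mostly_ge[OF w, where U = U]) auto
        then have "(\<integral>\<^sup>+x\<in>?S. ennreal (ln c - ln (w x)) \<partial>lebesgue) \<le> ennreal (?C * ?m)"
          using nn_integral_ln_deficit_le[OF w H S c] mS by simp
        moreover have "(\<integral>\<^sup>+x\<in>?R. (ennreal (ln c - ln (w x)) * indicator K x) \<partial>lebesgue)
            \<le> (\<integral>\<^sup>+x\<in>?R. ennreal (ln c - ln (w x)) \<partial>lebesgue)"
          by (intro nn_integral_mono) (auto simp: indicator_def)
        ultimately have "(\<integral>\<^sup>+x\<in>?R. (ennreal (ln c - ln (w x)) * indicator K x) \<partial>lebesgue) \<le> ennreal (?C * ?m)"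
          unfolding nn_integral_hcube_eq_cbox by (rule order_trans[rotated])
        \<comment> \<open>The failed test says that \<open>U\<close> fills more than
          \<open>?m / N\<close> of the stopped cube. Its cost \<open>?C * ?m\<close> is thus charged
          to the part of \<open>U\<close> inside it, at the price of the factor \<open>N\<close>;
          stopped cubes are disjoint, so no part is charged twice.\<close>
        also have "?C * ?m = N * ?C * (?m / N)"
          using N by simp
        also have "ennreal \<dots> = ennreal (N * ?C) * ennreal (?m / N)"
          using N corners(1) by (intro ennreal_mult'') auto
        also have "\<dots> \<le> ennreal (N * ?C) * emeasure lebesgue (?R \<inter> U)"
          using False by (intro mult_left_mono) auto
        also have "\<dots> = (\<integral>\<^sup>+x. ennreal (N * ?C) * indicator (?R \<inter> U) x \<partial>lebesgue)"
          by (rule nn_integral_cmult_indicator[symmetric]) measurable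
        also have "\<dots> = (\<integral>\<^sup>+x\<in>?R. (ennreal (N * ?C) * indicator U x) \<partial>lebesgue)"
          by (intro nn_integral_cong) (auto simp: indicator_def)
        finally show ?thesis .
      qed
      then show "(\<integral>\<^sup>+x\<in>hcube a l. (ennreal (ln c - ln (w x)) * indicator K x) \<partial>lebesgue)
          \<le> (\<integral>\<^sup>+x\<in>hcube a l. (ennreal (N * ?C) * indicator U x) \<partial>lebesgue)"
        by (subst (1 2) nn_integral_hcube_corners[OF corners(1)]) (auto intro!: sum_mono)
    qed
  qed
  then show ?thesis
    using assms(8,9,10,11) by blast
qed

text \<open>Runs the stopping time from \<open>Q\<close>, with \<open>K\<close> exhausting the
  exceptional set from inside and \<open>U\<close> shrinking to it from outside, so that the measure
  of \<open>U\<close> in the bound becomes that of the exceptional set.\<close>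

lemma nn_integral_ln_deficit_le_emeasure:
  fixes w :: "real^'n \<Rightarrow> real"
  defines "N \<equiv> 2 ^ (CARD('n) + 1)"
  assumes w: "weight w" and H: "hruscev w \<le> ennreal H" and Q: "Q \<in> cubes" and c: "0 < c"
    and E: "emeasure lebesgue {x \<in> Q. w x < c / 2} \<le> ennreal (measure lebesgue Q / (2 * N))"
  shows "(\<integral>\<^sup>+x\<in>{x \<in> Q. w x < c / 2}. ennreal (ln c - ln (w x)) \<partial>lebesgue)
    \<le> ennreal (N * (ln 4 + ln H + 1)) * emeasure lebesgue {x \<in> Q. w x < c / 2}"
    (is "?I \<le> ennreal ?C * emeasure lebesgue ?E")
proof (rule ennreal_le_epsilon)
  fix \<delta> :: real
  assume \<delta>: "0 < \<delta>"
  note [measurable] = weight_measurable[OF w] cube_sets[OF Q]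
  have E_sets [measurable]: "?E \<in> sets lebesgue"
    by measurable
  have N: "0 < N"
    by (simp add: N_def)
  have C: "0 < ?C"
    using N hruscev_ge_1[OF w H Q] by (intro mult_pos_pos add_nonneg_pos add_nonneg_nonneg) auto
  obtain a l where al: "0 < l" "Q = cbox a (\<chi> i. a $ i + l)"
    using Q by (rule cubesE)
  have mQ: "measure lebesgue Q = l ^ CARD('n)"
    using al measure_cbox_cube[of l a] by simp
  \<comment> \<open>The first bound keeps the measure of \<open>U\<close> below that of
    \<open>Q\<close> divided by \<open>N\<close>, so \<open>Q\<close> itself is not stopped; the
    second makes the resulting error \<open>?C * e\<close> at most \<open>\<delta>\<close>.\<close>
  define e where "e = min (measure lebesgue Q / (2 * N)) (\<delta> / ?C)"
  have e: "0 < e" "e \<le> measure lebesgue Q / (2 * N)"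
    using \<delta> C N cube_measure_pos[OF Q] by (auto simp: e_def)
  have cancel: "x * (\<delta> / x) = \<delta>" if "0 < x" for x
    using that by simp
  have "?C * e \<le> ?C * (\<delta> / ?C)"
    using C by (intro mult_left_mono) (auto simp: e_def)
  also have "\<dots> = \<delta>"
    by (rule cancel[OF C])
  finally have Ce: "?C * e \<le> \<delta>" .
  obtain U where U: "open U" "?E \<subseteq> U" "U - ?E \<in> lmeasurable" "emeasure lebesgue (U - ?E) < ennreal e"
    by (rule sets_lebesgue_outer_open[OF E_sets e(1)])
  have [measurable]: "U \<in> sets lebesgue"
    using U(1) by simp
  have "emeasure lebesgue U = emeasure lebesgue (?E \<union> (U - ?E))"
    using U(2) by (intro arg_cong[where f = "emeasure lebesgue"]) blast
  also have "\<dots> = emeasure lebesgue ?E + emeasure lebesgue (U - ?E)"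
    by (rule plus_emeasure[symmetric]) auto
  also have "\<dots> \<le> emeasure lebesgue ?E + ennreal e"
    using U(4) by (intro add_left_mono) auto
  finally have mU: "emeasure lebesgue U \<le> emeasure lebesgue ?E + ennreal e" .
  also have "\<dots> \<le> ennreal (measure lebesgue Q / (2 * N)) + ennreal (measure lebesgue Q / (2 * N))"
    using E e by (intro add_mono ennreal_leI)
  also have "\<dots> = ennreal (l ^ CARD('n) / N)"
    using N al(1) unfolding mQ by (subst ennreal_plus[symmetric]) auto
  finally have small: "emeasure lebesgue U \<le> ennreal (l ^ CARD('n) / N)" .
  have "?I \<le> ennreal ?C * emeasure lebesgue U"
  proof (rule nn_integral_le_of_compact_subsets)
    fix K assume K: "compact K" "K \<subseteq> ?E"
    have "(\<integral>\<^sup>+x\<in>K. ennreal (ln c - ln (w x)) \<partial>lebesgue)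
        = (\<integral>\<^sup>+x\<in>Q. (ennreal (ln c - ln (w x)) * indicator K x) \<partial>lebesgue)"
      using K(2) by (intro nn_integral_cong) (auto simp: indicator_def)
    also have "\<dots> = (\<integral>\<^sup>+x\<in>hcube a l. (ennreal (ln c - ln (w x)) * indicator K x) \<partial>lebesgue)"
      by (simp only: nn_integral_hcube_eq_cbox al(2))
    also have "\<dots> \<le> (\<integral>\<^sup>+x\<in>hcube a l. (ennreal ?C * indicator U x) \<partial>lebesgue)"
      unfolding N_def
    proof (rule nn_integral_ln_deficit_stopping[OF w H c K(1) U(1)])
      show "K \<subseteq> U"
        using K(2) U(2) by blast
      show "c / 2 \<le> w x" if "x \<in> Q - U" for x
        using that U(2) by force
      show "0 < l" "hcube a l \<subseteq> Q"
        using al hcube_subset_cbox by auto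
      show "emeasure lebesgue (hcube a l \<inter> U) \<le> ennreal (l ^ CARD('n) / 2 ^ (CARD('n) + 1))"
        using small unfolding N_def by (rule order_trans[rotated]) (intro emeasure_mono, auto)
    qed
    also have "\<dots> \<le> (\<integral>\<^sup>+x. ennreal ?C * indicator U x \<partial>lebesgue)"
      by (intro nn_integral_mono) (auto simp: indicator_def)
    also have "\<dots> = ennreal ?C * emeasure lebesgue U"
      by (rule nn_integral_cmult_indicator) measurable
    finally show "(\<integral>\<^sup>+x\<in>K. ennreal (ln c - ln (w x)) \<partial>lebesgue) \<le> ennreal ?C * emeasure lebesgue U" .
  qed measurable
  also have "\<dots> \<le> ennreal ?C * (emeasure lebesgue ?E + ennreal e)"
    by (rule mult_left_mono[OF mU]) simp
  also have "\<dots> = ennreal ?C * emeasure lebesgue ?E + ennreal (?C * e)"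
    unfolding ennreal_mult[OF less_imp_le[OF C] less_imp_le[OF e(1)]] by (rule distrib_left)
  also have "\<dots> \<le> ennreal ?C * emeasure lebesgue ?E + ennreal \<delta>"
    using Ce by (intro add_left_mono ennreal_leI)
  finally show "?I \<le> ennreal ?C * emeasure lebesgue ?E + ennreal \<delta>" .
qed

section \<open>The oscillation estimate\<close>

text \<open>Where w >= c / 2, the logarithm is Lipschitz in \<open>w\<close>: |ln w - ln c| is at
  most |w - c| / c above \<open>c\<close> and 2 |w - c| / c below it. Excess and deficit both have
  mean at most (F - 1) c, which gives the 3. The tail costs its constant times the measure of the
  exceptional set, at most 2 (F - 1) times that of \<open>Q\<close>.\<close>

lemma avg_abs_ln_le_flat:
  fixes w :: "real^'n \<Rightarrow> real"
  defines "N \<equiv> 2 ^ (CARD('n) + 1)"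
  assumes w: "weight w" and H: "hruscev w \<le> ennreal H" and F: "fujii_wilson w \<le> ennreal F"
    and Q: "Q \<in> cubes" and flat: "4 * N * (F - 1) \<le> 1"
  shows "avg Q (\<lambda>x. \<bar>ln (w x) - ln (avg Q w)\<bar>) \<le> (3 + 2 * (N * (ln 4 + ln H + 1))) * (F - 1)"
proof -
  note [measurable] = weight_measurable[OF w] cube_sets[OF Q]
  let ?c = "avg Q w" and ?m = "measure lebesgue Q" and ?C = "N * (ln 4 + ln H + 1)"
  let ?E = "{x \<in> Q. w x < ?c / 2}"
  let ?p = "\<lambda>x. max 0 (w x - ?c)" and ?q = "\<lambda>x. max 0 (?c - w x)"
  have c: "0 < ?c" and m: "0 < ?m" and N: "0 < N"
    using weight_avg_pos[OF w Q] cube_measure_pos[OF Q] by (auto simp: N_def)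
  have C: "0 < ?C"
    using N hruscev_ge_1[OF w H Q] by (intro mult_pos_pos add_nonneg_pos add_nonneg_nonneg) auto
  note ln = hruscev_integrable[OF w H Q] and int = weight_integrable[OF w Q]
  have E_sets [measurable]: "?E \<in> sets lebesgue"
    by measurable
  have intp: "set_integrable lebesgue Q ?p" and intq: "set_integrable lebesgue Q ?q"
    using Q int by (auto intro!: set_integrable_max_0)
  have p: "avg Q ?p \<le> (F - 1) * ?c"
    by (rule avg_excess_le_fujii_wilson[OF w F Q])
  \<comment> \<open>Since \<open>w - ?c\<close> has mean zero, the bound on the excess transfers to
    the deficit.\<close>
  have "avg Q (\<lambda>x. ?p x - ?q x) = avg Q (\<lambda>x. w x - ?c)"
    by (intro arg_cong[where f = "avg Q"]) (auto simp: max_def)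
  then have pq: "avg Q ?q = avg Q ?p"
    using Q int by (simp add: avg_diff[OF intp intq] avg_diff)
  have F1: "0 \<le> F - 1"
  proof -
    have "0 \<le> avg Q ?p"
      using avg_mono[of Q "\<lambda>x. 0" ?p] Q intp by simp
    then show ?thesis
      using p c by (metis order_trans zero_le_mult_iff not_less)
  qed
  \<comment> \<open>Chebyshev's inequality: the deficit exceeds \<open>?c / 2\<close> on
    \<open>?E\<close>.\<close>
  have "ennreal (?c / 2) * emeasure lebesgue ?E = (\<integral>\<^sup>+x. ennreal (?c / 2) * indicator ?E x \<partial>lebesgue)"
    by (rule nn_integral_cmult_indicator[symmetric]) measurable
  also have "\<dots> \<le> (\<integral>\<^sup>+x\<in>Q. ennreal (?q x) \<partial>lebesgue)"
    using c by (intro nn_integral_mono) (auto simp: indicator_def max_def intro!: ennreal_leI)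
  also have "\<dots> = ennreal (?m * avg Q ?q)"
    by (rule nn_integral_eq_avg[OF Q intq]) simp
  also have "\<dots> \<le> ennreal (?m * ((F - 1) * ?c))"
    using p m unfolding pq by (intro ennreal_leI mult_left_mono) auto
  also have "?m * ((F - 1) * ?c) = ?c / 2 * (2 * (F - 1) * ?m)"
    by simp
  also have "ennreal \<dots> = ennreal (?c / 2) * ennreal (2 * (F - 1) * ?m)"
    using c F1 m by (intro ennreal_mult) auto
  finally have E: "emeasure lebesgue ?E \<le> ennreal (2 * (F - 1) * ?m)"
    using c by (subst (asm) ennreal_mult_le_mult_iff) auto
  also have "\<dots> \<le> ennreal (?m / (2 * N))"
  proof (rule ennreal_leI)
    have "2 * (F - 1) \<le> 1 / (2 * N)"
      using flat N by (simp add: field_simps)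
    then have "2 * (F - 1) * ?m \<le> 1 / (2 * N) * ?m"
      using m by (intro mult_right_mono) auto
    then show "2 * (F - 1) * ?m \<le> ?m / (2 * N)"
      by simp
  qed
  finally have tail: "(\<integral>\<^sup>+x\<in>?E. ennreal (ln ?c - ln (w x)) \<partial>lebesgue)
      \<le> ennreal ?C * emeasure lebesgue ?E"
    unfolding N_def by (rule nn_integral_ln_deficit_le_emeasure[OF w H Q c])
  have pointwise: "AE x in lebesgue. ennreal \<bar>ln (w x) - ln ?c\<bar> * indicator Q x
      \<le> ennreal (1 / ?c * ?p x + 2 / ?c * ?q x) * indicator Q x
        + ennreal (ln ?c - ln (w x)) * indicator ?E x"
    using weight_pos[OF w]
  proof eventually_elim
    case (elim x)
    consider "x \<notin> Q" | "x \<in> Q" "?c \<le> w x" | "x \<in> Q" "?c / 2 \<le> w x" "w x < ?c" | "x \<in> ?E"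
      using c by fastforce
    then show ?case
    proof cases
      case 2
      have "ln (w x / ?c) \<le> w x / ?c - 1"
        using elim c by (intro ln_le_minus_one) auto
      moreover have "ln (w x / ?c) = ln (w x) - ln ?c"
        using elim c by (subst ln_div) auto
      moreover have "1 / ?c * ?p x = w x / ?c - 1" "2 / ?c * ?q x = 0"
        using 2 c by (simp_all add: max_absorb2 max_absorb1 diff_divide_distrib)
      moreover have "ln ?c \<le> ln (w x)"
        using 2 c by simp
      ultimately have "\<bar>ln (w x) - ln ?c\<bar> \<le> 1 / ?c * ?p x + 2 / ?c * ?q x"
        by linarith
      then show ?thesis
        using 2 by (auto simp: indicator_def intro!: ennreal_leI add_increasing2)
    next
      case 3
      have "ln (?c / w x) \<le> ?c / w x - 1"
        using elim c by (intro ln_le_minus_one) auto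
      moreover have "ln (?c / w x) = ln ?c - ln (w x)"
        using elim c by (subst ln_div) auto
      moreover have "?c / w x - 1 = (?c - w x) / w x"
        using elim by (simp add: field_simps)
      moreover have "(?c - w x) / w x \<le> (?c - w x) / (?c / 2)"
        using 3 c by (intro divide_left_mono) auto
      moreover have "1 / ?c * ?p x = 0" "2 / ?c * ?q x = (?c - w x) / (?c / 2)"
        using 3 by (simp_all add: max_absorb2 max_absorb1)
      moreover have "ln (w x) \<le> ln ?c"
        using 3 elim by simp
      ultimately have "\<bar>ln (w x) - ln ?c\<bar> \<le> 1 / ?c * ?p x + 2 / ?c * ?q x"
        by linarith
      then show ?thesis
        using 3 by (auto simp: indicator_def intro!: ennreal_leI add_increasing2)
    next
      case 4
      have "w x < ?c"
        using 4 c by auto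
      then have "ln (w x) \<le> ln ?c"
        using elim by simp
      then have "\<bar>ln (w x) - ln ?c\<bar> = ln ?c - ln (w x)"
        by simp
      then show ?thesis
        using 4 by (auto intro: add_increasing)
    qed auto
  qed
  have absint: "set_integrable lebesgue Q (\<lambda>x. \<bar>ln (w x) - ln ?c\<bar>)"
    using Q ln by (auto intro!: set_integrable_abs)
  have intpq: "set_integrable lebesgue Q (\<lambda>x. 1 / ?c * ?p x + 2 / ?c * ?q x)"
    by (intro set_integral_add set_integrable_mult_right intp intq)
  have "avg Q (\<lambda>x. 1 / ?c * ?p x + 2 / ?c * ?q x) = 1 / ?c * avg Q ?p + 2 / ?c * avg Q ?q"
    by (subst avg_add) (intro set_integrable_mult_right intp intq, intro set_integrable_mult_right intp intq, simp only: avg_cmult)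
  also have "\<dots> = 3 / ?c * avg Q ?p"
    unfolding pq by (simp add: field_simps)
  also have "\<dots> \<le> 3 / ?c * ((F - 1) * ?c)"
    using p c by (intro mult_left_mono) auto
  finally have avgpq: "avg Q (\<lambda>x. 1 / ?c * ?p x + 2 / ?c * ?q x) \<le> 3 * (F - 1)"
    using c by simp
  have "ennreal (?m * avg Q (\<lambda>x. \<bar>ln (w x) - ln ?c\<bar>)) = (\<integral>\<^sup>+x\<in>Q. ennreal \<bar>ln (w x) - ln ?c\<bar> \<partial>lebesgue)"
    by (rule nn_integral_eq_avg[OF Q absint, symmetric]) simp
  also have "\<dots> \<le> (\<integral>\<^sup>+x. (ennreal (1 / ?c * ?p x + 2 / ?c * ?q x) * indicator Q x
        + ennreal (ln ?c - ln (w x)) * indicator ?E x) \<partial>lebesgue)"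
    by (rule nn_integral_mono_AE[OF pointwise])
  also have "\<dots> = (\<integral>\<^sup>+x\<in>Q. ennreal (1 / ?c * ?p x + 2 / ?c * ?q x) \<partial>lebesgue)
        + (\<integral>\<^sup>+x\<in>?E. ennreal (ln ?c - ln (w x)) \<partial>lebesgue)"
    by (rule nn_integral_add) measurable
  also have "(\<integral>\<^sup>+x\<in>Q. ennreal (1 / ?c * ?p x + 2 / ?c * ?q x) \<partial>lebesgue)
      = ennreal (?m * avg Q (\<lambda>x. 1 / ?c * ?p x + 2 / ?c * ?q x))"
    using c by (intro nn_integral_eq_avg[OF Q intpq]) auto
  also have "\<dots> + (\<integral>\<^sup>+x\<in>?E. ennreal (ln ?c - ln (w x)) \<partial>lebesgue)
      \<le> ennreal (?m * (3 * (F - 1))) + ennreal ?C * ennreal (2 * (F - 1) * ?m)"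
  proof (intro add_mono)
    show "ennreal (?m * avg Q (\<lambda>x. 1 / ?c * ?p x + 2 / ?c * ?q x)) \<le> ennreal (?m * (3 * (F - 1)))"
      using avgpq m by (intro ennreal_leI mult_left_mono) auto
    show "(\<integral>\<^sup>+x\<in>?E. ennreal (ln ?c - ln (w x)) \<partial>lebesgue) \<le> ennreal ?C * ennreal (2 * (F - 1) * ?m)"
      by (rule order_trans[OF tail mult_left_mono[OF E]]) simp
  qed
  also have "\<dots> = ennreal (?m * (3 * (F - 1)) + ?C * (2 * (F - 1) * ?m))"
  proof -
    have "0 \<le> 2 * (F - 1) * ?m" "0 \<le> ?m * (3 * (F - 1))"
      using F1 m by auto
    then show ?thesis
      unfolding ennreal_mult[OF less_imp_le[OF C] \<open>0 \<le> 2 * (F - 1) * ?m\<close>, symmetric]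
      using C by (intro ennreal_plus[symmetric]) (auto intro: mult_nonneg_nonneg less_imp_le)
  qed
  also have "?m * (3 * (F - 1)) + ?C * (2 * (F - 1) * ?m) = ?m * ((3 + 2 * ?C) * (F - 1))"
    by (simp add: algebra_simps)
  finally have "?m * avg Q (\<lambda>x. \<bar>ln (w x) - ln ?c\<bar>) \<le> ?m * ((3 + 2 * ?C) * (F - 1))"
    using m F1 C by (subst (asm) ennreal_le_iff) auto
  then show ?thesis
    using m by simp
qed

lemma ex_cube: "\<exists>Q :: (real^'n) set. Q \<in> cubes"
  by (auto simp: cubes_def intro!: exI[of _ "1 :: real"])

lemma fujii_wilson_ge_1:
  fixes w :: "real^'n \<Rightarrow> real"
  assumes w: "weight w" and F: "fujii_wilson w \<le> ennreal F"
  shows "1 \<le> F"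
proof -
  obtain Q :: "(real^'n) set" where Q: "Q \<in> cubes"
    using ex_cube by blast
  have "0 \<le> avg Q (\<lambda>x. max 0 (w x - avg Q w))"
    using avg_mono[of Q "\<lambda>x. 0" "\<lambda>x. max 0 (w x - avg Q w)"] Q weight_integrable[OF w Q]
    by (auto simp: set_integrable_max_0)
  then have "0 \<le> (F - 1) * avg Q w"
    using avg_excess_le_fujii_wilson[OF w F Q] by linarith
  then show ?thesis
    using weight_avg_pos[OF w Q] by (simp add: zero_le_mult_iff)
qed

text \<open>Write L = ln (2 H), which is at least ln 2 >= 1 / 2. For large F - 1, the direct bound 2
  (ln H + 2) is at most 10 L, and 1 < 4 N (F - 1) supplies the missing factor; this fixes the
  constant 40. For small F - 1 the same estimates of the constants by L give at most 32 N L (F -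
  1).\<close>

lemma avg_oscillation_ln_le:
  fixes w :: "real^'n \<Rightarrow> real"
  defines "N \<equiv> 2 ^ (CARD('n) + 1)"
  assumes w: "weight w" and H: "hruscev w \<le> ennreal H" and F: "fujii_wilson w \<le> ennreal F"
    and Q: "Q \<in> cubes"
  shows "avg Q (\<lambda>x. \<bar>ln (w x) - avg Q (\<lambda>x. ln (w x))\<bar>) \<le> 40 * N * ln (2 * H) * (F - 1)"
proof -
  let ?L = "ln (2 * H)" and ?osc = "avg Q (\<lambda>x. \<bar>ln (w x) - avg Q (\<lambda>x. ln (w x))\<bar>)"
  have H1: "1 \<le> H" and F1: "1 \<le> F" and N: "1 \<le> N"
    unfolding N_def by (rule hruscev_ge_1[OF w H Q] fujii_wilson_ge_1[OF w F] one_le_power one_le_numeral)+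
  have L: "?L = ln 2 + ln H"
    using H1 by (intro ln_mult_pos) auto
  have ln2: "1 / 2 \<le> ln (2 :: real)"
    using ln_add_one_self_le_self2[of "- 1 / 2"] by (simp add: ln_div)
  have ln4: "ln (4 :: real) = 2 * ln 2"
    using ln_realpow[of "2 :: real" 2] by simp
  have lnH: "0 \<le> ln H"
    using H1 by simp
  show ?thesis
  proof (cases "4 * N * (F - 1) \<le> 1")
    case True
    have "?osc \<le> 2 * avg Q (\<lambda>x. \<bar>ln (w x) - ln (avg Q w)\<bar>)"
      by (rule avg_abs_diff_avg_le[OF Q hruscev_integrable[OF w H Q]])
    also have "\<dots> \<le> 2 * ((3 + 2 * (N * (ln 4 + ln H + 1))) * (F - 1))"
      using avg_abs_ln_le_flat[OF w H F Q] True unfolding N_def by simp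
    also have "\<dots> = (6 + 4 * (N * (ln 4 + ln H + 1))) * (F - 1)"
      by (simp add: algebra_simps)
    also have "\<dots> \<le> (40 * N * ?L) * (F - 1)"
    proof (rule mult_right_mono)
      \<comment> \<open>Naming the product leaves inequalities that are linear in \<open>T\<close>
        and \<open>?L\<close>.\<close>
      define T where "T = N * ?L"
      have "6 \<le> 12 * ?L"
        using ln2 lnH L by simp
      moreover have "?L \<le> T"
        unfolding T_def using N ln2 lnH L by simp
      moreover have "N * (ln 4 + ln H + 1) \<le> N * (5 * ?L)"
        using N ln2 ln4 lnH L by (intro mult_left_mono) auto
      moreover have "N * (5 * ?L) = 5 * T" "40 * N * ?L = 40 * T"
        by (simp_all add: T_def)
      ultimately show "6 + 4 * (N * (ln 4 + ln H + 1)) \<le> 40 * N * ?L"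
        using ln2 lnH L by linarith
    qed (use F1 in simp)
    finally show ?thesis .
  next
    case False
    have "?osc \<le> 2 * (ln H + 2)"
      by (rule avg_oscillation_ln_le_hruscev[OF w H Q])
    also have "\<dots> \<le> (10 * ?L) * 1"
      using ln2 lnH L by simp
    also have "\<dots> \<le> (10 * ?L) * (4 * N * (F - 1))"
      using False ln2 lnH L by (intro mult_left_mono) auto
    finally show ?thesis
      by (simp add: algebra_simps)
  qed
qed

theorem theorem1p3:
  shows "\<exists>c::real. 0 < c \<and>
    (\<forall>w :: real^'n \<Rightarrow> real. w \<in> A_inf \<longrightarrow>
       (\<lambda>x. ln (w x)) \<in> BMO \<and>
       enn2ereal (BMO_seminorm (\<lambda>x. ln (w x)))
         \<le> ereal c * eln (2 * hruscev w) * (enn2ereal (fujii_wilson w) - 1))"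
proof (intro exI[of _ "40 * 2 ^ (CARD('n) + 1)"] conjI allI impI)
  fix w :: "real^'n \<Rightarrow> real"
  assume "w \<in> A_inf"
  then have w: "weight w" and fin: "hruscev w < \<infinity>"
    by (rule hruscev_finite)+
  obtain Q :: "(real^'n) set" where Q: "Q \<in> cubes"
    using ex_cube by blast
  obtain H where H: "0 \<le> H" "hruscev w = ennreal H"
    using fin by (cases "hruscev w") auto
  have H1: "1 \<le> H"
    by (rule hruscev_ge_1[OF w _ Q]) (simp add: H)
  \<comment> \<open>Membership in \<open>BMO\<close> rests on the Hruscev constant alone, as
    \<open>fujii_wilson w\<close> is not known to be finite at this point.\<close>
  have "locally_integrable (\<lambda>x. ln (w x))"
    by (rule locally_integrable_cubesI) (rule hruscev_integrable[OF w eq_refl[OF H(2)]])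
  moreover have "BMO_seminorm (\<lambda>x. ln (w x)) \<le> ennreal (2 * (ln H + 2))"
    by (rule BMO_seminorm_leI) (rule avg_oscillation_ln_le_hruscev[OF w eq_refl[OF H(2)]])
  ultimately show "(\<lambda>x. ln (w x)) \<in> BMO"
    unfolding BMO_def by (auto intro: le_less_trans)
  have "2 * hruscev w = ennreal (2 * H)"
    using H by (simp add: ennreal_mult')
  then have eln: "eln (2 * hruscev w) = ereal (ln (2 * H))"
    using H1 by (simp add: eln_def)
  have L: "0 < ln (2 * H)"
    using H1 by simp
  show "enn2ereal (BMO_seminorm (\<lambda>x. ln (w x)))
      \<le> ereal (40 * 2 ^ (CARD('n) + 1)) * eln (2 * hruscev w) * (enn2ereal (fujii_wilson w) - 1)"
  proof (cases "fujii_wilson w")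
    case (real F)
    have F1: "1 \<le> F"
      by (rule fujii_wilson_ge_1[OF w]) (simp add: real)
    have "BMO_seminorm (\<lambda>x. ln (w x)) \<le> ennreal (40 * 2 ^ (CARD('n) + 1) * ln (2 * H) * (F - 1))"
      by (rule BMO_seminorm_leI)
         (rule avg_oscillation_ln_le[OF w eq_refl[OF H(2)] eq_refl[OF real(2)]])
    then have "enn2ereal (BMO_seminorm (\<lambda>x. ln (w x)))
        \<le> enn2ereal (ennreal (40 * 2 ^ (CARD('n) + 1) * ln (2 * H) * (F - 1)))"
      by (simp add: less_eq_ennreal.rep_eq)
    also have "\<dots> = ereal (40 * 2 ^ (CARD('n) + 1) * ln (2 * H) * (F - 1))"
      using F1 L by (intro enn2ereal_ennreal) auto
    finally show ?thesis
      using real by (simp add: eln enn2ereal_ennreal one_ereal_def)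
  next
    \<comment> \<open>Here the right side is infinite, because \<open>ln (2 * H)\<close> is strictly
      positive, and the estimate is trivial.\<close>
    case top
    then show ?thesis
      using L by (simp add: eln)
  qed
qed simp

end
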